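(* Let $T=(T_\omega)_{\omega\in\Omega}$ be a continuous bundle random dynamical system on a compact metric space $(X,d)$ over $(\Omega,\mathcal{F},\mathbf{P},\vartheta)$. Then for $\mathbf{P}$-a.e. $\omega\in\Omega$, $$h_{top}^{(r)}(\omega,X,T)=\overline{h}^{(r)}_{FK}(\omega,X,T)=\underline{h}^{(r)}_{FK}(\omega,X,T).$$
   Context: Setting. $(\Omega,\mathcal{F},\mathbf{P})$ is a probability space with $\mathcal{F}$ complete, countably generated and separating points (so it is a Lebesgue space), and $\vartheta:\Omega\to\Omega$ is an invertible ergodic $\mathbf{P}$-preserving transformation. $(X,d)$ is a compact metric space with Borel $\sigma$-algebra $\mathcal{B}$. A continuous bundle random dynamical system (RDS) $T=(T_\omega)_\omega$ over $(\Omega,\mathcal{F},\mathbf{P},\vartheta)$ is a family of maps $T_\omega:X\to X$ such that $(\omega,x)\mapsto T_\omega(x)$ is measurable with respect to $\mathcal{F}\times\mathcal{B}$ and $x\mapsto T_\omega(x)$ is continuous for $\mathbf{P}$-a.e. $\omega$. Iterates: $T^0_\omega=\mathrm{id}$ and $T^n_\omega=T_{\vartheta^{n-1}\omega}\circ\cdots\circ T_{\vartheta\omega}\circ T_\omega$ for $n\ge 1$. Bowen metric. $d^n_\omega(x,y)=\max_{0\le i\le n-1}d(T^i_\omega(x),T^i_\omega(y))$. Feldman-Katok (FK) metric. For $n\in\mathbb{N}$, $\varepsilon>0$, $x,y\in X$, an $(\omega,n,\varepsilon)$-match of $x$ and $y$ is an order preserving bijection $\pi:D(\pi)\to R(\pi)$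 (i.e. $\pi(i)<\pi(j)$ whenever $i<j$) with $D(\pi),R(\pi)\subset\{0,1,\dots,n-1\}$ such that $d(T^i_\omega(x),T^{\pi(i)}_\omega(y))<\varepsilon$ for every $i\in D(\pi)$ (the empty match is allowed). Let $|\pi|$ be the cardinality of $D(\pi)$, and put $$\bar f_{\omega,n,\varepsilon}(x,y)=1-\tfrac1n\max\{|\pi|:\pi\text{ is an }(\omega,n,\varepsilon)\text{-match of }x\text{ and }y\},$$ $$d^{FK_n}_\omega(x,y)=\inf\{\varepsilon>0:\bar f_{\omega,n,\varepsilon}(x,y)<\varepsilon\}.$$ Entropies. A set $E\subset X$ is FK-$(\omega,n,\varepsilon)$ spanning if for all $x\in X$ there is $y\in E$ with $d^{FK_n}_\omega(x,y)\le\varepsilon$; $sp_{FK}(\omega,n,\varepsilon)$ is the smallest cardinality of such a set. Define $$\overline{h}^{(r)}_{FK}(\omega,X,T)=\lim_{\varepsilon\to0}\limsup_{n\to\infty}\tfrac1n\log sp_{FK}(\omega,n,\varepsilon),\qquad \underline{h}^{(r)}_{FK}(\omega,X,T)=\lim_{\varepsilon\to0}\liminf_{n\to\infty}\tfrac1n\log sp_{FK}(\omega,n,\varepsilon).$$ Let $r(\omega,n,\varepsilon)$ be the analogous smallest cardinality with $d^{FK_n}_\omega$ replaced by $d^n_\omega$. The fiber topological entropy of $T$ with respect to $\omega$ is $$h_{top}^{(r)}(\omega,X,T)=\lim_{\varepsilon\to0}\liminf_{n\to\infty}\tfrac1n\log r(\omega,n,\varepsilon)=\lim_{\varepsilon\to0}\limsup_{n\to\infty}\tfrac1n\log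 r(\omega,n,\varepsilon),$$ the equality of the two limits being a known fact (for $\mathbf{P}$-a.e. $\omega$). *)

theory Defs
  imports "HOL-Probability.Probability"
begin

text \<open>
  ``Complete, countably generated, separating points'' is meant as for Lebesgue spaces: the
  \<sigma>-algebra is the completion of a \<sigma>-algebra generated by a countable family that separates
  points. (A \<sigma>-algebra that is itself both countably generated and complete is covered as well,
  but asking for this would exclude the Lebesgue \<sigma>-algebra of the unit interval.)
\<close>

locale lebesgue_prob_space = prob_space P + complete_measure P for P :: "'w measure" +
  assumes separable_mod0:
    "\<exists>C. countable C \<and> C \<subseteq> sets P
       \<and> (\<forall>x\<in>space P. \<forall>y\<in>space P. x \<noteq> y \<longrightarrow> (\<exists>A\<in>C. (x \<in> A) \<noteq> (y \<in> A)))
       \<and> P = completion (measure_of (space P) C (emeasure P))"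

locale ergodic_automorphism = lebesgue_prob_space P for P :: "'w measure" +
  fixes \<theta> :: "'w \<Rightarrow> 'w"
  assumes bij: "bij_betw \<theta> (space P) (space P)"
    and measurable_base: "\<theta> \<in> measurable P P"
    and measurable_inverse: "the_inv_into (space P) \<theta> \<in> measurable P P"
    and preserving: "distr P P \<theta> = P"
    and ergodic: "\<And>A. A \<in> sets P \<Longrightarrow> \<theta> -` A \<inter> space P = A \<Longrightarrow> prob A = 0 \<or> prob A = 1"

locale continuous_bundle_rds = ergodic_automorphism P \<theta>
  for P :: "'w measure" and \<theta> :: "'w \<Rightarrow> 'w" +
  fixes T :: "'w \<Rightarrow> 'x::metric_space \<Rightarrow> 'x"
  assumes measurable_rds: "(\<lambda>(\<omega>, x). T \<omega> x) \<in> measurable (P \<Otimes>\<^sub>M borel) borel"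
    and continuous_rds: "AE \<omega> in P. continuous_on UNIV (T \<omega>)"

primrec rds_iter :: "('w \<Rightarrow> 'w) \<Rightarrow> ('w \<Rightarrow> 'x \<Rightarrow> 'x) \<Rightarrow> nat \<Rightarrow> 'w \<Rightarrow> 'x \<Rightarrow> 'x" where
  "rds_iter \<theta> T 0 \<omega> = id"
| "rds_iter \<theta> T (Suc n) \<omega> = T ((\<theta> ^^ n) \<omega>) \<circ> rds_iter \<theta> T n \<omega>"

text \<open>The metrics below are meaningful for positive \<open>n\<close> only; the value at \<open>n = 0\<close> does not
  influence the limits in \<open>n\<close>.\<close>

definition bowen_dist ::
  "('w \<Rightarrow> 'w) \<Rightarrow> ('w \<Rightarrow> 'x::metric_space \<Rightarrow> 'x) \<Rightarrow> 'w \<Rightarrow> nat \<Rightarrow> 'x \<Rightarrow> 'x \<Rightarrow> real" where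
  "bowen_dist \<theta> T \<omega> n x y =
     Max ((\<lambda>i. dist (rds_iter \<theta> T i \<omega> x) (rds_iter \<theta> T i \<omega> y)) ` {..<n})"

text \<open>A match is given by its domain \<open>D\<close> and a map \<open>\<pi>\<close>, of which only the restriction to \<open>D\<close>
  is relevant; its range is \<open>\<pi> ` D\<close>.\<close>

definition fk_match ::
  "('w \<Rightarrow> 'w) \<Rightarrow> ('w \<Rightarrow> 'x::metric_space \<Rightarrow> 'x) \<Rightarrow> 'w \<Rightarrow> nat \<Rightarrow> real \<Rightarrow> 'x \<Rightarrow> 'x
     \<Rightarrow> nat set \<Rightarrow> (nat \<Rightarrow> nat) \<Rightarrow> bool" where
  "fk_match \<theta> T \<omega> n \<epsilon> x y D \<pi> \<longleftrightarrow>
     D \<subseteq> {..<n} \<and> \<pi> ` D \<subseteq> {..<n} \<and> strict_mono_on D \<pi> \<and>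
     (\<forall>i\<in>D. dist (rds_iter \<theta> T i \<omega> x) (rds_iter \<theta> T (\<pi> i) \<omega> y) < \<epsilon>)"

definition fk_fbar ::
  "('w \<Rightarrow> 'w) \<Rightarrow> ('w \<Rightarrow> 'x::metric_space \<Rightarrow> 'x) \<Rightarrow> 'w \<Rightarrow> nat \<Rightarrow> real \<Rightarrow> 'x \<Rightarrow> 'x \<Rightarrow> real" where
  "fk_fbar \<theta> T \<omega> n \<epsilon> x y =
     1 - real (Max {card D | D \<pi>. fk_match \<theta> T \<omega> n \<epsilon> x y D \<pi>}) / real n"

definition fk_dist ::
  "('w \<Rightarrow> 'w) \<Rightarrow> ('w \<Rightarrow> 'x::metric_space \<Rightarrow> 'x) \<Rightarrow> 'w \<Rightarrow> nat \<Rightarrow> 'x \<Rightarrow> 'x \<Rightarrow> real" where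
  "fk_dist \<theta> T \<omega> n x y = Inf {\<epsilon>. 0 < \<epsilon> \<and> fk_fbar \<theta> T \<omega> n \<epsilon> x y < \<epsilon>}"

definition spanning :: "('x \<Rightarrow> 'x \<Rightarrow> real) \<Rightarrow> real \<Rightarrow> 'x set \<Rightarrow> bool" where
  "spanning \<rho> \<epsilon> E \<longleftrightarrow> (\<forall>x. \<exists>y\<in>E. \<rho> x y \<le> \<epsilon>)"

text \<open>The value is \<open>\<infinity>\<close> if there is no finite spanning set.\<close>

definition span_number :: "('x \<Rightarrow> 'x \<Rightarrow> real) \<Rightarrow> real \<Rightarrow> enat" where
  "span_number \<rho> \<epsilon> = Inf {enat (card E) | E. finite E \<and> spanning \<rho> \<epsilon> E}"

definition ln_enat :: "enat \<Rightarrow> ereal" where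
  "ln_enat k = (case k of enat m \<Rightarrow> ereal (ln (real m)) | \<infinity> \<Rightarrow> \<infinity>)"

definition upper_growth :: "(nat \<Rightarrow> 'x \<Rightarrow> 'x \<Rightarrow> real) \<Rightarrow> ereal" where
  "upper_growth \<rho> =
     Lim (at_right 0) (\<lambda>\<epsilon>. limsup (\<lambda>n. ln_enat (span_number (\<rho> n) \<epsilon>) / ereal (real n)))"

definition lower_growth :: "(nat \<Rightarrow> 'x \<Rightarrow> 'x \<Rightarrow> real) \<Rightarrow> ereal" where
  "lower_growth \<rho> =
     Lim (at_right 0) (\<lambda>\<epsilon>. liminf (\<lambda>n. ln_enat (span_number (\<rho> n) \<epsilon>) / ereal (real n)))"

definition fk_entropy_upper ::
  "('w \<Rightarrow> 'w) \<Rightarrow> ('w \<Rightarrow> 'x::metric_space \<Rightarrow> 'x) \<Rightarrow> 'w \<Rightarrow> ereal" where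
  "fk_entropy_upper \<theta> T \<omega> = upper_growth (fk_dist \<theta> T \<omega>)"

definition fk_entropy_lower ::
  "('w \<Rightarrow> 'w) \<Rightarrow> ('w \<Rightarrow> 'x::metric_space \<Rightarrow> 'x) \<Rightarrow> 'w \<Rightarrow> ereal" where
  "fk_entropy_lower \<theta> T \<omega> = lower_growth (fk_dist \<theta> T \<omega>)"

text \<open>The fiber topological entropy is the common value, for almost every \<open>\<omega>\<close>, of the lower and
  the upper growth rate for the Bowen metrics. It is defined as the lower one; that the upper one
  agrees with it has to be stated separately.\<close>

definition fiber_top_entropy ::
  "('w \<Rightarrow> 'w) \<Rightarrow> ('w \<Rightarrow> 'x::metric_space \<Rightarrow> 'x) \<Rightarrow> 'w \<Rightarrow> ereal" where
  "fiber_top_entropy \<theta> T \<omega> = lower_growth (bowen_dist \<theta> T \<omega>)"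

end

theory Submission
  imports Defs "HOL-Real_Asymp.Real_Asymp"
begin

text \<open>
  Since \<open>d\<^sup>F\<^sup>K\<close> is dominated by the Bowen metric, the chain of inequalities
  \<open>lower Bowen \<le> lower FK \<le> upper FK \<le> upper Bowen \<le> lower Bowen\<close> needs only two arguments.

  The first inequality holds for every \<open>\<omega>\<close>. A match between \<open>x\<close> and a point \<open>y\<close> of an FK-spanning set
  leaves out about \<open>\<epsilon>n\<close> times. The domain and the range of the match determine it, and \<open>x\<close> is
  located at the unmatched times by the points of a finite \<open>\<delta>/2\<close>-net with \<open>K\<close> elements, so that the
  Bowen number at scale \<open>\<delta>\<close> is at most \<open>(n choose \<epsilon>n)\<^sup>2 K\<^bsup>\<epsilon>n\<^esup>\<close> times the FK number at scale \<open>\<epsilon>\<close>. As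
  \<open>\<delta>\<close> is fixed while \<open>\<epsilon>\<close> tends to 0, this factor has arbitrarily small growth rate.

  The last inequality is a subadditive ergodic theorem for the number of words needed to cover the
  orbits up to \<open>\<delta>\<close>. The lower growth rate of a subadditive process is a.e. a constant \<open>g\<close>; outside
  a set \<open>B\<close> of small measure it is almost attained within a bounded time, so an orbit can be cut
  greedily into blocks with average close to \<open>g\<close>, up to the visits to \<open>B\<close>. That these visits are rare
  follows from the same greedy cutting, applied to the number of visits to the complement of \<open>B\<close> and
  integrated.
\<close>

section \<open>Growth rates and matches\<close>

text \<open>\<open>Lim\<close> is unspecified unless the limit exists. Monotonicity in the scale
  provides it and turns growth rates into suprema, so that later estimates can be made at one scale
  at a time.\<close>

lemma Lim_at_right_antimono:
  fixes F :: "real \<Rightarrow> ereal"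
  assumes anti: "\<And>x y. 0 < x \<Longrightarrow> x \<le> y \<Longrightarrow> F y \<le> F x"
  shows "Lim (at_right 0) F = (SUP x\<in>{0<..}. F x)"
proof (rule tendsto_Lim)
  show "(F \<longlongrightarrow> (SUP x\<in>{0<..}. F x)) (at_right 0)"
  proof (rule order_tendstoI)
    fix a assume "a < (SUP x\<in>{0<..}. F x)"
    then obtain x where "0 < x" "a < F x"
      by (auto simp: less_SUP_iff)
    have "\<forall>\<^sub>F y in at_right 0. y \<in> {0<..<x}"
      using \<open>0 < x\<close> by (rule eventually_at_right_real)
    then show "\<forall>\<^sub>F y in at_right 0. a < F y"
    proof (rule eventually_mono)
      fix y assume "y \<in> {0<..<x}"
      then show "a < F y"
        using anti[of y x] \<open>a < F x\<close> by (auto intro: less_le_trans)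
    qed
  next
    fix a assume less: "(SUP x\<in>{0<..}. F x) < a"
    show "\<forall>\<^sub>F y in at_right 0. F y < a"
    proof (rule eventually_mono[OF eventually_at_right_less])
      fix y :: real assume "0 < y"
      then show "F y < a"
        by (intro le_less_trans[OF SUP_upper less]) simp
    qed
  qed
qed simp

lemma ln_enat_mono: "m \<le> n \<Longrightarrow> 0 < m \<Longrightarrow> ln_enat m \<le> ln_enat n"
  by (cases m; cases n) (auto simp: ln_enat_def zero_enat_def)

lemma ln_enat_divide_mono:
  "m \<le> n \<Longrightarrow> 0 < m \<Longrightarrow> ln_enat m / ereal (real k) \<le> ln_enat n / ereal (real k)"
  unfolding divide_ereal_def by (intro ereal_mult_right_mono ln_enat_mono inverse_ereal_ge0I) auto

lemma span_number_pos: "0 < span_number \<rho> \<epsilon>"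
proof -
  have "1 \<le> span_number \<rho> \<epsilon>"
    unfolding span_number_def
  proof (rule Inf_greatest, clarify)
    fix E assume "finite E" "spanning \<rho> \<epsilon> E"
    then have "1 \<le> card E" by (auto simp: spanning_def Suc_le_eq card_gt_0_iff)
    then show "1 \<le> enat (card E)" by (simp add: one_enat_def)
  qed
  then show ?thesis by (metis gr_zeroI not_one_le_zero)
qed

lemma span_number_le: "finite E \<Longrightarrow> spanning \<rho> \<epsilon> E \<Longrightarrow> span_number \<rho> \<epsilon> \<le> enat (card E)"
  unfolding span_number_def by (rule Inf_lower) blast

lemma span_number_mono:
  assumes "\<And>x y. \<rho> x y \<le> \<epsilon> \<Longrightarrow> \<rho>' x y \<le> \<epsilon>'"
  shows "span_number \<rho>' \<epsilon>' \<le> span_number \<rho> \<epsilon>"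
  unfolding span_number_def by (rule Inf_superset_mono) (use assms in \<open>fastforce simp: spanning_def\<close>)

lemma span_number_eq_card:
  assumes "span_number \<rho> \<epsilon> = enat k"
  obtains E where "finite E" "spanning \<rho> \<epsilon> E" "card E = k"
proof -
  let ?S = "{enat (card E) |E. finite E \<and> spanning \<rho> \<epsilon> E}"
  have "?S \<noteq> {}"
    using assms unfolding span_number_def by (auto simp: Inf_enat_def split: if_splits)
  then have "Inf ?S \<in> ?S"
    by (metis (no_types, lifting) Inf_enat_def LeastI_ex ex_in_conv)
  then show ?thesis
    using assms that unfolding span_number_def by auto
qed

lemma upper_growth_eq_SUP:
  "upper_growth \<rho> = (SUP \<epsilon>\<in>{0<..}. limsup (\<lambda>n. ln_enat (span_number (\<rho> n) \<epsilon>) / ereal (real n)))"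
  unfolding upper_growth_def
proof (rule Lim_at_right_antimono, rule Limsup_mono, rule always_eventually, rule allI)
  fix x y :: real and n assume "x \<le> y"
  then show "ln_enat (span_number (\<rho> n) y) / ereal (real n) \<le> ln_enat (span_number (\<rho> n) x) / ereal (real n)"
    by (intro ln_enat_divide_mono span_number_mono span_number_pos) simp
qed

lemma lower_growth_eq_SUP:
  "lower_growth \<rho> = (SUP \<epsilon>\<in>{0<..}. liminf (\<lambda>n. ln_enat (span_number (\<rho> n) \<epsilon>) / ereal (real n)))"
  unfolding lower_growth_def
proof (rule Lim_at_right_antimono, rule Liminf_mono, rule always_eventually, rule allI)
  fix x y :: real and n assume "x \<le> y"
  then show "ln_enat (span_number (\<rho> n) y) / ereal (real n) \<le> ln_enat (span_number (\<rho> n) x) / ereal (real n)"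
    by (intro ln_enat_divide_mono span_number_mono span_number_pos) simp
qed

lemma lower_growth_le_upper_growth: "lower_growth \<rho> \<le> upper_growth \<rho>"
  unfolding lower_growth_eq_SUP upper_growth_eq_SUP
  by (intro SUP_mono') (simp add: Liminf_le_Limsup)

lemma upper_growth_mono:
  assumes "\<And>n x y. 0 < n \<Longrightarrow> \<rho> n x y \<le> \<rho>' n x y"
  shows "upper_growth \<rho> \<le> upper_growth \<rho>'"
  unfolding upper_growth_eq_SUP
proof (rule SUP_mono', rule Limsup_mono, rule eventually_mono[OF eventually_gt_at_top[of 0]])
  fix \<epsilon> and n :: nat assume "0 < n"
  then show "ln_enat (span_number (\<rho> n) \<epsilon>) / ereal (real n) \<le> ln_enat (span_number (\<rho>' n) \<epsilon>) / ereal (real n)"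
    by (intro ln_enat_divide_mono span_number_mono span_number_pos) (rule order_trans[OF assms])
qed

text \<open>One point is picked from each piece; for an empty piece it is arbitrary, which does no
  harm. The pieces will come from combinatorial data: matches with net points, and later
  words.\<close>

lemma span_number_le_card_cover:
  assumes "finite I" and cover: "\<And>x. \<exists>i\<in>I. x \<in> A i"
    and small: "\<And>i x y. i \<in> I \<Longrightarrow> x \<in> A i \<Longrightarrow> y \<in> A i \<Longrightarrow> \<rho> x y \<le> \<delta>"
  shows "span_number \<rho> \<delta> \<le> enat (card I)"
proof -
  let ?E = "(\<lambda>i. SOME y. y \<in> A i) ` I"
  have "spanning \<rho> \<delta> ?E"
    unfolding spanning_def
  proof
    fix x
    obtain i where "i \<in> I" "x \<in> A i" using cover by blast
    then show "\<exists>y\<in>?E. \<rho> x y \<le> \<delta>"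
      using small someI[of "\<lambda>y. y \<in> A i" x] by blast
  qed
  then have "span_number \<rho> \<delta> \<le> enat (card ?E)"
    using \<open>finite I\<close> by (intro span_number_le) auto
  also have "\<dots> \<le> enat (card I)"
    using \<open>finite I\<close> by (simp add: card_image_le)
  finally show ?thesis .
qed

section \<open>Bowen and Feldman-Katok distances\<close>

lemma bowen_dist_le:
  assumes "0 < n" "\<And>i. i < n \<Longrightarrow> dist (rds_iter \<theta> T i \<omega> x) (rds_iter \<theta> T i \<omega> y) \<le> \<delta>"
  shows "bowen_dist \<theta> T \<omega> n x y \<le> \<delta>"
  using assms unfolding bowen_dist_def by (subst Max_le_iff) auto

lemma dist_le_bowen_dist:
  assumes "i < n"
  shows "dist (rds_iter \<theta> T i \<omega> x) (rds_iter \<theta> T i \<omega> y) \<le> bowen_dist \<theta> T \<omega> n x y"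
  using assms unfolding bowen_dist_def by (intro Max_ge) auto

text \<open>This gives the \<open>Max\<close> in \<open>fk_fbar\<close> its meaning: match sizes are
  at most \<open>n\<close>, and the empty match is always available.\<close>

lemma fk_match_cards:
  shows finite_fk_match_cards: "finite {card D |D \<pi>. fk_match \<theta> T \<omega> n \<epsilon> x y D \<pi>}"
    and fk_match_cards_nonempty: "{card D |D \<pi>. fk_match \<theta> T \<omega> n \<epsilon> x y D \<pi>} \<noteq> {}"
proof -
  have "{card D |D \<pi>. fk_match \<theta> T \<omega> n \<epsilon> x y D \<pi>} \<subseteq> {..n}"
    by (auto simp: fk_match_def dest!: card_mono[rotated])
  then show "finite {card D |D \<pi>. fk_match \<theta> T \<omega> n \<epsilon> x y D \<pi>}"
    using finite_subset by blast
  have "fk_match \<theta> T \<omega> n \<epsilon> x y {} id"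
    by (simp add: fk_match_def strict_mono_on_def)
  then show "{card D |D \<pi>. fk_match \<theta> T \<omega> n \<epsilon> x y D \<pi>} \<noteq> {}"
    by blast
qed

lemma fk_fbar_le_1: "fk_fbar \<theta> T \<omega> n \<epsilon> x y \<le> 1"
  by (simp add: fk_fbar_def)

text \<open>Strictly above the Bowen distance the identity matches all \<open>n\<close> times, so
  \<open>fk_fbar\<close> is at most 0. The slack \<open>e\<close> is there because matches ask for
  strict inequalities.\<close>

lemma fk_dist_le_bowen_dist:
  assumes "0 < n"
  shows "fk_dist \<theta> T \<omega> n x y \<le> bowen_dist \<theta> T \<omega> n x y"
proof (rule field_le_epsilon)
  fix e :: real assume "0 < e"
  let ?d = "bowen_dist \<theta> T \<omega> n x y" and ?C = "{card D |D \<pi>. fk_match \<theta> T \<omega> n (bowen_dist \<theta> T \<omega> n x y + e) x y D \<pi>}"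
  have "0 \<le> ?d"
    by (rule order_trans[OF zero_le_dist dist_le_bowen_dist[OF assms]])
  have "dist (rds_iter \<theta> T i \<omega> x) (rds_iter \<theta> T i \<omega> y) < ?d + e" if "i < n" for i
    using dist_le_bowen_dist[OF that, of \<theta> T \<omega> x y] \<open>0 < e\<close> by linarith
  then have "fk_match \<theta> T \<omega> n (?d + e) x y {..<n} id"
    by (auto simp: fk_match_def strict_mono_on_def)
  then have "card {..<n} \<in> ?C"
    by blast
  then have "n \<le> Max ?C"
    using Max_ge[OF finite_fk_match_cards] by simp
  then have "fk_fbar \<theta> T \<omega> n (?d + e) x y \<le> 0"
    using assms by (simp add: fk_fbar_def field_simps)
  then have "?d + e \<in> {\<epsilon>. 0 < \<epsilon> \<and> fk_fbar \<theta> T \<omega> n \<epsilon> x y < \<epsilon>}"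
    using \<open>0 \<le> ?d\<close> \<open>0 < e\<close> by auto
  then show "fk_dist \<theta> T \<omega> n x y \<le> ?d + e"
    unfolding fk_dist_def by (rule cInf_lower) (auto intro: bdd_belowI[of _ 0])
qed

lemma fk_dist_less_imp_match:
  assumes "0 < n" "fk_dist \<theta> T \<omega> n x y < \<epsilon>"
  obtains D \<pi> where "fk_match \<theta> T \<omega> n \<epsilon> x y D \<pi>" "(1 - \<epsilon>) * real n < real (card D)"
proof -
  let ?S = "{\<epsilon>. 0 < \<epsilon> \<and> fk_fbar \<theta> T \<omega> n \<epsilon> x y < \<epsilon>}"
  \<comment> \<open>As \<open>fk_fbar\<close> never exceeds 1, the infimum is taken over a nonempty
    set and can be approximated from within.\<close>
  have "2 \<in> ?S"
    using fk_fbar_le_1[of \<theta> T \<omega> n 2 x y] by simp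
  then obtain e where e: "0 < e" "fk_fbar \<theta> T \<omega> n e x y < e" "e < \<epsilon>"
    using assms(2) cInf_lessD[of ?S \<epsilon>] unfolding fk_dist_def by blast
  let ?C = "{card D |D \<pi>. fk_match \<theta> T \<omega> n e x y D \<pi>}"
  have "Max ?C \<in> ?C"
    by (rule Max_in[OF finite_fk_match_cards fk_match_cards_nonempty])
  then obtain D \<pi> where D: "Max ?C = card D" "fk_match \<theta> T \<omega> n e x y D \<pi>"
    by blast
  have "(1 - e) * real n < real (card D)"
    using e(2) \<open>0 < n\<close> D(1) by (simp add: fk_fbar_def field_simps)
  moreover have "(1 - \<epsilon>) * real n \<le> (1 - e) * real n"
    using e(3) by (intro mult_right_mono) auto
  moreover have "fk_match \<theta> T \<omega> n \<epsilon> x y D \<pi>"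
    using D(2) e(3) by (auto simp: fk_match_def)
  ultimately show ?thesis
    using that by simp
qed

text \<open>If one map takes the other's value at \<open>i\<close> already at an earlier index,
  strict monotonicity contradicts the induction hypothesis; otherwise
  \<open>g i \<le> f i \<le> g i\<close>. Hence a match can be counted by its domain and range
  alone.\<close>

lemma strict_mono_on_image_unique:
  fixes f g :: "nat \<Rightarrow> nat"
  assumes f: "strict_mono_on D f" and g: "strict_mono_on D g" and "f ` D = g ` D" and "i \<in> D"
  shows "f i = g i"
  using \<open>i \<in> D\<close>
proof (induction i rule: less_induct)
  case (less i)
  obtain j where j: "j \<in> D" "f i = g j" using assms(3) less.prems by blast
  obtain k where k: "k \<in> D" "g i = f k" using assms(3) less.prems by (metis imageE imageI)
  show ?case
  proof (cases "j < i \<or> k < i")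
    case True
    then show ?thesis
      using less.IH[of j] less.IH[of k] j k less.prems strict_mono_onD[OF f] strict_mono_onD[OF g]
      by (metis less_irrefl)
  next
    case False
    then have "g i \<le> g j" "f i \<le> f k"
      using j k less.prems strict_mono_onD[OF f, of i k] strict_mono_onD[OF g, of i j]
      by (metis leI nat_less_le order_refl)+
    then show ?thesis using j k by simp
  qed
qed

section \<open>Comparison of the Bowen and the FK spanning numbers\<close>

text \<open>\<open>m\<close> bounds the number of unmatched times. Trimming each match to exactly
  \<open>n - m\<close> pairs leaves \<open>n choose m\<close> choices each for domain and range, and
  \<open>card Q ^ m\<close> choices of net points at the other times. Together with the spanning
  point these data fix a piece of Bowen diameter at most \<open>\<delta>\<close>.\<close>

lemma span_number_bowen_le_fk:
  fixes T :: "'w \<Rightarrow> 'x::metric_space \<Rightarrow> 'x" and Q :: "'x set"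
  assumes "finite Q" and net: "\<And>x. \<exists>q\<in>Q. dist x q < \<delta> / 2"
    and "0 < n" "0 < \<epsilon>" "4 * \<epsilon> \<le> \<delta>" "m \<le> n" "2 * \<epsilon> * real n < real (Suc m)"
    and "finite E" and E: "spanning (fk_dist \<theta> T \<omega> n) \<epsilon> E"
  shows "span_number (bowen_dist \<theta> T \<omega> n) \<delta> \<le> enat (card E * (n choose m)\<^sup>2 * card Q ^ m)"
proof -
  let ?f = "\<lambda>i. rds_iter \<theta> T i \<omega>"
  let ?S = "{D. D \<subseteq> {..<n} \<and> card D = n - m}"
  let ?J = "E \<times> ?S \<times> ?S"
  let ?I = "SIGMA p : ?J. PiE ({..<n} - fst (snd p)) (\<lambda>_. Q)"
  \<comment> \<open>Although \<open>\<pi>\<close> is only asserted to exist, \<open>D\<close> and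
    \<open>R\<close> determine it, so all points of a piece are matched to \<open>y\<close> in the
    same way.\<close>
  define A where "A = (\<lambda>((y, D, R), c). {x. \<exists>\<pi>. strict_mono_on D \<pi> \<and> \<pi> ` D = R \<and>
    (\<forall>i\<in>D. dist (?f i x) (?f (\<pi> i) y) < 2 * \<epsilon>) \<and> (\<forall>i\<in>{..<n} - D. dist (?f i x) (c i) < \<delta> / 2)})"
  have S: "finite ?S" "card ?S = n choose m"
    using n_subsets[of "{..<n}" "n - m"] \<open>m \<le> n\<close> by (simp_all add: binomial_symmetric[of m n])
  have "finite ?I"
    using \<open>finite E\<close> S(1) \<open>finite Q\<close> by (intro finite_SigmaI finite_PiE) auto
  have "card ?I = (\<Sum>p\<in>?J. card (PiE ({..<n} - fst (snd p)) (\<lambda>_. Q)))"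
    using \<open>finite E\<close> S(1) \<open>finite Q\<close> by (intro card_SigmaI ballI finite_PiE) auto
  also have "\<dots> = (\<Sum>p\<in>?J. card Q ^ m)"
  proof (rule sum.cong[OF refl])
    fix p assume "p \<in> ?J"
    then have D: "fst (snd p) \<subseteq> {..<n}" "card (fst (snd p)) = n - m" by auto
    then have "card ({..<n} - fst (snd p)) = m"
      using \<open>m \<le> n\<close> by (subst card_Diff_subset) (auto intro: finite_subset)
    then show "card (PiE ({..<n} - fst (snd p)) (\<lambda>_. Q)) = card Q ^ m"
      by (simp add: card_PiE)
  qed
  also have "\<dots> = card E * (n choose m)\<^sup>2 * card Q ^ m"
    by (simp only: sum_constant card_cartesian_product S(2) power2_eq_square of_nat_id)
  finally have card: "card ?I = card E * (n choose m)\<^sup>2 * card Q ^ m" .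
  have "span_number (bowen_dist \<theta> T \<omega> n) \<delta> \<le> enat (card ?I)"
  proof (rule span_number_le_card_cover)
    show "finite ?I" by fact
  next
    fix x
    obtain y where "y \<in> E" "fk_dist \<theta> T \<omega> n x y \<le> \<epsilon>"
      using E unfolding spanning_def by blast
    \<comment> \<open>Doubling the scale makes the inequality strict, as the extraction of a match
      requires.\<close>
    then have "fk_dist \<theta> T \<omega> n x y < 2 * \<epsilon>" using \<open>0 < \<epsilon>\<close> by simp
    then obtain D \<pi> where D: "fk_match \<theta> T \<omega> n (2 * \<epsilon>) x y D \<pi>" "(1 - 2 * \<epsilon>) * real n < real (card D)"
      by (rule fk_dist_less_imp_match[OF \<open>0 < n\<close>])
    have "real n < real (card D + Suc m)"
      using D(2) \<open>2 * \<epsilon> * real n < real (Suc m)\<close> by (simp add: algebra_simps)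
    then have "n - m \<le> card D" by linarith
    then obtain D' where D': "D' \<subseteq> D" "card D' = n - m"
      by (meson obtain_subset_with_card_n)
    have mono: "strict_mono_on D' \<pi>"
      using D(1) D'(1) unfolding fk_match_def by (meson monotone_on_subset)
    then have "card (\<pi> ` D') = n - m"
      using D'(2) by (simp add: card_image strict_mono_on_imp_inj_on)
    then have R: "\<pi> ` D' \<in> ?S" "D' \<in> ?S"
      using D(1) D' by (auto simp: fk_match_def)
    obtain c where c: "\<And>z. c z \<in> Q" "\<And>z. dist z (c z) < \<delta> / 2"
      using net by metis
    let ?c = "restrict (\<lambda>i. c (?f i x)) ({..<n} - D')"
    have "((y, D', \<pi> ` D'), ?c) \<in> ?I"
      using R \<open>y \<in> E\<close> c(1) by simp
    moreover have "x \<in> A ((y, D', \<pi> ` D'), ?c)"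
      using mono c(2) D(1) D'(1) by (auto simp: A_def fk_match_def intro!: exI[of _ \<pi>])
    ultimately show "\<exists>i\<in>?I. x \<in> A i" by blast
  next
    fix i x x' assume "i \<in> ?I" and x: "x \<in> A i" and x': "x' \<in> A i"
    obtain y D R c where i: "i = ((y, D, R), c)" by (metis surj_pair)
    obtain \<pi> where \<pi>: "strict_mono_on D \<pi>" "\<pi> ` D = R"
      "\<And>i. i \<in> D \<Longrightarrow> dist (?f i x) (?f (\<pi> i) y) < 2 * \<epsilon>" "\<And>i. i \<in> {..<n} - D \<Longrightarrow> dist (?f i x) (c i) < \<delta> / 2"
      using x unfolding i A_def by auto
    obtain \<pi>' where \<pi>': "strict_mono_on D \<pi>'" "\<pi>' ` D = R"
      "\<And>i. i \<in> D \<Longrightarrow> dist (?f i x') (?f (\<pi>' i) y) < 2 * \<epsilon>" "\<And>i. i \<in> {..<n} - D \<Longrightarrow> dist (?f i x') (c i) < \<delta> / 2"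
      using x' unfolding i A_def by auto
    show "bowen_dist \<theta> T \<omega> n x x' \<le> \<delta>"
    proof (rule bowen_dist_le[OF \<open>0 < n\<close>])
      fix i assume "i < n"
      show "dist (?f i x) (?f i x') \<le> \<delta>"
      proof (cases "i \<in> D")
        case True
        \<comment> \<open>Both orbits are therefore within \<open>2 * \<epsilon>\<close> of the same
          point, whence the condition \<open>4 * \<epsilon> \<le> \<delta>\<close>.\<close>
        have "\<pi>' i = \<pi> i"
          using strict_mono_on_image_unique[OF \<pi>(1) \<pi>'(1) _ True] \<pi>(2) \<pi>'(2) by simp
        then show ?thesis
          using \<pi>(3)[OF True] \<pi>'(3)[OF True] \<open>4 * \<epsilon> \<le> \<delta>\<close>
            dist_triangle2[of "?f i x" "?f i x'" "?f (\<pi> i) y"] by simp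
      next
        case False
        then show ?thesis
          using \<pi>(4)[of i] \<pi>'(4)[of i] \<open>i < n\<close> dist_triangle2[of "?f i x" "?f i x'" "c i"] by simp
      qed
    qed
  qed
  then show ?thesis unfolding card .
qed

text \<open>One term of the binomial expansion of \<open>(1 + t) ^ n\<close> is at most the whole
  sum. The free parameter \<open>t\<close> will be the scale \<open>\<epsilon>\<close>, which makes
  the bound per time step small when \<open>m\<close> is at most
  \<open>2 * \<epsilon> * n\<close>.\<close>

lemma ln_binomial_le:
  assumes "m \<le> n" "0 < t"
  shows "ln (real (n choose m)) \<le> real n * ln (1 + t) - real m * ln t"
proof -
  have "real (n choose m) * t ^ m * 1 ^ (n - m) \<le> (\<Sum>k\<le>n. real (n choose k) * t ^ k * 1 ^ (n - k))"
    by (rule member_le_sum[where f = "\<lambda>k. real (n choose k) * t ^ k * 1 ^ (n - k)"]) (use assms in auto)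
  also have "\<dots> = (1 + t) ^ n"
    by (subst add.commute, subst binomial_ring) simp
  finally have "ln (real (n choose m) * t ^ m) \<le> ln ((1 + t) ^ n)"
    using assms by (subst ln_le_cancel_iff) auto
  then show ?thesis
    using assms by (simp add: ln_mult ln_realpow)
qed

lemma ln_span_number_bowen_le_fk:
  fixes T :: "'w \<Rightarrow> 'x::metric_space \<Rightarrow> 'x" and Q :: "'x set"
  assumes "finite Q" and net: "\<And>x. \<exists>q\<in>Q. dist x q < \<delta> / 2"
    and "0 < n" "0 < \<epsilon>" "4 * \<epsilon> \<le> \<delta>" "2 * \<epsilon> \<le> 1"
  shows "ln_enat (span_number (bowen_dist \<theta> T \<omega> n) \<delta>) / ereal (real n)
    \<le> ereal (2 * (ln (1 + \<epsilon>) - 2 * \<epsilon> * ln \<epsilon>) + 2 * \<epsilon> * ln (real (card Q)))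
      + ln_enat (span_number (fk_dist \<theta> T \<omega> n) \<epsilon>) / ereal (real n)"
proof (cases "span_number (fk_dist \<theta> T \<omega> n) \<epsilon>")
  case infinity
  then show ?thesis using \<open>0 < n\<close> by (simp add: ln_enat_def)
next
  case (enat k)
  then obtain E where E: "finite E" "spanning (fk_dist \<theta> T \<omega> n) \<epsilon> E" "card E = k"
    by (rule span_number_eq_card)
  have "0 < k"
    using span_number_pos[of "fk_dist \<theta> T \<omega> n" \<epsilon>] enat by (simp add: zero_enat_def)
  define m where "m = nat \<lfloor>2 * \<epsilon> * real n\<rfloor>"
  have m_le: "real m \<le> 2 * \<epsilon> * real n" and m_gt: "2 * \<epsilon> * real n < real (Suc m)"
    using \<open>0 < \<epsilon>\<close> unfolding m_def by (simp_all add: of_nat_nat) linarith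
  have "2 * \<epsilon> * real n \<le> 1 * real n"
    using \<open>2 * \<epsilon> \<le> 1\<close> by (intro mult_right_mono) auto
  with m_le have "m \<le> n" by simp
  have "Q \<noteq> {}" using net by blast
  then have Q: "1 \<le> card Q" using \<open>finite Q\<close> by (simp add: Suc_le_eq card_gt_0_iff)
  obtain l where l: "span_number (bowen_dist \<theta> T \<omega> n) \<delta> = enat l" "l \<le> k * (n choose m)\<^sup>2 * card Q ^ m"
    using span_number_bowen_le_fk[OF assms(1-5) \<open>m \<le> n\<close> m_gt E(1,2)] E(3)
    by (cases "span_number (bowen_dist \<theta> T \<omega> n) \<delta>") auto
  have "0 < l"
    using span_number_pos[of "bowen_dist \<theta> T \<omega> n" \<delta>] l(1) by (simp add: zero_enat_def)
  then have "ln (real l) \<le> ln (real (k * (n choose m)\<^sup>2 * card Q ^ m))"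
    using l(2) by (intro ln_mono) (simp_all only: of_nat_le_iff of_nat_0_less_iff)
  also have "\<dots> = ln (real k) + 2 * ln (real (n choose m)) + real m * ln (real (card Q))"
    using \<open>0 < k\<close> \<open>m \<le> n\<close> Q by (simp add: ln_mult ln_realpow)
  also have "\<dots> \<le> ln (real k) + 2 * (real n * ln (1 + \<epsilon>) - (2 * \<epsilon> * real n) * ln \<epsilon>)
      + (2 * \<epsilon> * real n) * ln (real (card Q))"
  proof (intro add_mono mult_left_mono mult_right_mono order_refl)
    \<comment> \<open>Since \<open>\<epsilon> < 1\<close>, the factor \<open>- ln \<epsilon>\<close>
      is positive and \<open>m\<close> may be replaced by its upper bound.\<close>
    have "real m * (- ln \<epsilon>) \<le> (2 * \<epsilon> * real n) * (- ln \<epsilon>)"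
      using m_le \<open>0 < \<epsilon>\<close> \<open>2 * \<epsilon> \<le> 1\<close> by (intro mult_right_mono) auto
    with ln_binomial_le[OF \<open>m \<le> n\<close> \<open>0 < \<epsilon>\<close>]
    show "ln (real (n choose m)) \<le> real n * ln (1 + \<epsilon>) - (2 * \<epsilon> * real n) * ln \<epsilon>"
      by simp
  qed (use m_le Q in auto)
  finally have "ln (real l) / real n
      \<le> 2 * (ln (1 + \<epsilon>) - 2 * \<epsilon> * ln \<epsilon>) + 2 * \<epsilon> * ln (real (card Q)) + ln (real k) / real n"
    using \<open>0 < n\<close> by (simp add: field_simps)
  then show ?thesis
    using \<open>0 < n\<close> by (simp add: l(1) enat ln_enat_def)
qed

lemma compact_UNIV_finite_net:
  assumes "compact (UNIV :: 'x::metric_space set)" "0 < e"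
  obtains Q :: "'x::metric_space set" where "finite Q" "\<And>x. \<exists>q\<in>Q. dist x q < e"
proof -
  obtain Q :: "'x::metric_space set" where Q: "finite Q" "UNIV \<subseteq> (\<Union>q\<in>Q. ball q e)"
    using assms unfolding compact_eq_totally_bounded by blast
  have "\<exists>q\<in>Q. dist x q < e" for x
    using subsetD[OF Q(2) UNIV_I, of x] by (auto simp: dist_commute)
  with Q(1) that show ?thesis by blast
qed

text \<open>The net \<open>Q\<close> depends on \<open>\<delta>\<close> only, so it stays fixed
  while \<open>\<epsilon>\<close> tends to 0 and the error \<open>\<eta> \<epsilon>\<close>
  disappears.\<close>

lemma lower_growth_bowen_le_fk:
  fixes T :: "'w \<Rightarrow> 'x::metric_space \<Rightarrow> 'x"
  assumes "compact (UNIV :: 'x set)"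
  shows "lower_growth (bowen_dist \<theta> T \<omega>) \<le> lower_growth (fk_dist \<theta> T \<omega>)"
    (is "_ \<le> ?L")
  unfolding lower_growth_eq_SUP[of "bowen_dist \<theta> T \<omega>"]
proof (rule SUP_least)
  fix \<delta> :: real assume "\<delta> \<in> {0<..}"
  then have "0 < \<delta>" by simp
  let ?Y = "liminf (\<lambda>n. ln_enat (span_number (bowen_dist \<theta> T \<omega> n) \<delta>) / ereal (real n))"
  obtain Q :: "'x set" where Q: "finite Q" "\<And>x. \<exists>q\<in>Q. dist x q < \<delta> / 2"
    using compact_UNIV_finite_net[OF assms, of "\<delta> / 2"] \<open>0 < \<delta>\<close> by auto
  define \<eta> where "\<eta> \<epsilon> = 2 * (ln (1 + \<epsilon>) - 2 * \<epsilon> * ln \<epsilon>) + 2 * \<epsilon> * ln (real (card Q))" for \<epsilon>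
  have le: "?Y \<le> ereal (\<eta> \<epsilon>) + ?L" if "0 < \<epsilon>" "4 * \<epsilon> \<le> \<delta>" "2 * \<epsilon> \<le> 1" for \<epsilon>
  proof -
    have "?Y \<le> liminf (\<lambda>n. ereal (\<eta> \<epsilon>) + ln_enat (span_number (fk_dist \<theta> T \<omega> n) \<epsilon>) / ereal (real n))"
      unfolding \<eta>_def using ln_span_number_bowen_le_fk[OF Q _ that]
      by (intro Liminf_mono eventually_mono[OF eventually_gt_at_top[of 0]])
    also have "\<dots> = ereal (\<eta> \<epsilon>) + liminf (\<lambda>n. ln_enat (span_number (fk_dist \<theta> T \<omega> n) \<epsilon>) / ereal (real n))"
      by (rule ereal_liminf_lim_add) auto
    also have "\<dots> \<le> ereal (\<eta> \<epsilon>) + ?L"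
      unfolding lower_growth_eq_SUP using \<open>0 < \<epsilon>\<close> by (intro add_left_mono SUP_upper) auto
    finally show ?thesis .
  qed
  have "\<forall>\<^sub>F \<epsilon> in at_right 0. \<epsilon> \<in> {0<..<min (\<delta> / 4) (1 / 2)}"
    using \<open>0 < \<delta>\<close> by (intro eventually_at_right_real) auto
  then have ev: "\<forall>\<^sub>F \<epsilon> in at_right 0. ?Y \<le> ereal (\<eta> \<epsilon>) + ?L"
    by (rule eventually_mono) (auto intro!: le)
  have \<eta>: "(\<eta> \<longlongrightarrow> 0) (at_right 0)"
    unfolding \<eta>_def by real_asymp
  show "?Y \<le> ?L"
  \<comment> \<open>The limit is taken for finite \<open>?L\<close>; if \<open>?L\<close> is minus
    infinity, a single admissible \<open>\<epsilon>\<close> already bounds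
    \<open>?Y\<close>.\<close>
  proof (cases ?L)
    case (real r)
    have "((\<lambda>\<epsilon>. ereal (\<eta> \<epsilon> + r)) \<longlongrightarrow> ereal (0 + r)) (at_right 0)"
      by (intro tendsto_ereal tendsto_intros \<eta>)
    then have "?Y \<le> ereal (0 + r)"
      by (rule tendsto_lowerbound) (use ev real in simp_all)
    then show ?thesis by (simp add: real)
  next
    case MInf
    with ev show ?thesis
      using eventually_happens'[of "at_right (0::real)"] by (auto simp: trivial_limit_at_right_real)
  qed simp
qed

section \<open>Bounded subadditive processes\<close>

lemma sum_lessThan_add:
  fixes f :: "nat \<Rightarrow> 'b::comm_monoid_add"
  shows "sum f {..<m + n} = sum f {..<m} + (\<Sum>i<n. f (m + i))"
  by (induction n) (simp_all add: add.assoc)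

text \<open>At times in \<open>B\<close> advance by one step, at other times by a good \<open>l\<close>, until fewer than \<open>N\<close> steps
  are left.\<close>

lemma greedy_subadditive_bound:
  fixes b :: "nat \<Rightarrow> nat \<Rightarrow> real"
  assumes subadd: "\<And>k m n. b k (m + n) \<le> b k m + b (k + m) n"
    and bound: "\<And>k n. b k n \<le> C * real n" and "0 \<le> C" "0 \<le> c"
    and good: "\<And>k. k \<notin> B \<Longrightarrow> \<exists>l\<in>{1..N}. b k l \<le> c * real l"
  shows "b k n \<le> c * real n + C * (\<Sum>i<n. indicator B (k + i)) + C * real N"
proof (induction n arbitrary: k rule: less_induct)
  case (less n)
  let ?S = "\<lambda>k n. \<Sum>i<n. indicator B (k + i) :: real"
  have S0: "0 \<le> ?S k n" for k n
    by (simp add: sum_nonneg)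
  have split: "?S k (l + m) = ?S k l + ?S (k + l) m" for k l m
    by (simp add: sum_lessThan_add add.assoc)
  show ?case
  proof (cases "n \<le> N")
    \<comment> \<open>The final stretch of at most \<open>N\<close> steps is paid for by
      \<open>C * real N\<close>.\<close>
    case True
    have "b k n \<le> C * real n" by (rule bound)
    also have "\<dots> \<le> C * real N" using True \<open>0 \<le> C\<close> by (simp add: mult_left_mono)
    finally show ?thesis
      using S0[of k n] \<open>0 \<le> C\<close> \<open>0 \<le> c\<close> by (smt (verit) mult_nonneg_nonneg of_nat_0_le_iff)
  next
    case False
    \<comment> \<open>The first block: a bad time is charged \<open>C\<close> through its own
      indicator, a good one pays \<open>c\<close> per step, and \<open>l \<le> N < n\<close> makes
      the block fit.\<close>
    have "\<exists>l\<ge>1. l \<le> n \<and> b k l \<le> c * real l + C * ?S k l"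
    proof (cases "k \<in> B")
      case True
      have "b k 1 \<le> c * real 1 + C * ?S k 1"
        using bound[of k 1] True \<open>0 \<le> c\<close> by simp
      then show ?thesis using False by (intro exI[of _ 1]) auto
    next
      case nB: False
      then obtain l where "l \<in> {1..N}" "b k l \<le> c * real l" using good by blast
      moreover have "0 \<le> C * ?S k l" using S0[of k l] \<open>0 \<le> C\<close> by simp
      ultimately show ?thesis using False by (intro exI[of _ l]) auto
    qed
    then obtain l where l: "1 \<le> l" "l \<le> n" "b k l \<le> c * real l + C * ?S k l" by blast
    define m where "m = n - l"
    have n: "n = l + m" and "m < n" using l by (simp_all add: m_def)
    have "b k n \<le> b k l + b (k + l) m" unfolding n by (rule subadd)
    also have "\<dots> \<le> (c * real l + C * ?S k l) + (c * real m + C * ?S (k + l) m + C * real N)"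
      using l(3) less.IH[OF \<open>m < n\<close>] by (rule add_mono)
    also have "\<dots> = c * real n + C * ?S k n + C * real N"
      unfolding n split by (simp add: algebra_simps)
    finally show ?thesis .
  qed
qed

section \<open>Measure preservation and ergodicity of the base\<close>

context ergodic_automorphism
begin

lemma funpow_measurable: "(\<theta> ^^ n) \<in> measurable P P"
proof (induction n)
  case (Suc n)
  then show ?case
    using measurable_comp[OF Suc measurable_base] by (simp only: funpow.simps)
qed (simp add: id_def)

lemma funpow_space: "\<omega> \<in> space P \<Longrightarrow> (\<theta> ^^ n) \<omega> \<in> space P"
  using funpow_measurable by (rule measurable_space)

lemma distr_funpow: "distr P P (\<theta> ^^ n) = P"
proof (induction n)
  case 0
  then show ?case by (simp add: id_def distr_id)
next
  case (Suc n)
  have "distr P P (\<theta> ^^ Suc n) = distr (distr P P (\<theta> ^^ n)) P \<theta>"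
    using distr_distr[OF measurable_base funpow_measurable[of n]] by (simp only: funpow.simps)
  then show ?case by (simp only: Suc preserving)
qed

lemma AE_funpow:
  assumes "AE \<omega> in P. Q \<omega>"
  shows "AE \<omega> in P. Q ((\<theta> ^^ n) \<omega>)"
  by (rule AE_distrD[OF funpow_measurable]) (simp only: distr_funpow assms)

lemma prob_vimage_funpow:
  assumes "A \<in> sets P"
  shows "prob ((\<theta> ^^ n) -` A \<inter> space P) = prob A"
  using measure_distr[OF funpow_measurable assms, of n] by (simp add: distr_funpow)

text \<open>The iterated preimages of \<open>A\<close> increase and all have the measure of
  \<open>A\<close>, hence so does their union. The union is exactly invariant, as
  \<open>ergodic\<close> requires.\<close>

lemma prob_subinvariant_0_or_1:
  assumes A[measurable]: "A \<in> sets P" and sub: "A \<subseteq> \<theta> -` A"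
  shows "prob A = 0 \<or> prob A = 1"
proof -
  let ?A = "\<lambda>n. (\<theta> ^^ n) -` A \<inter> space P"
  have sets: "?A n \<in> sets P" for n
    using funpow_measurable A by (rule measurable_sets)
  have step: "?A n \<subseteq> ?A (Suc n)" for n
    using sub by auto
  then have "incseq ?A"
    by (rule incseq_SucI)
  then have "(\<lambda>n. prob (?A n)) \<longlonglongrightarrow> prob (\<Union>n. ?A n)"
    using sets by (intro finite_Lim_measure_incseq) auto
  then have "prob (\<Union>n. ?A n) = prob A"
    by (simp only: prob_vimage_funpow[OF A] LIMSEQ_const_iff)
  moreover have "\<theta> -` (\<Union>n. ?A n) \<inter> space P = (\<Union>n. ?A n)"
  proof -
    have "\<theta> -` (\<Union>n. ?A n) \<inter> space P = (\<Union>n. ?A (Suc n))"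
      using measurable_space[OF measurable_base] by (auto simp: funpow_swap1)
    also have "\<dots> = (\<Union>n. ?A n)"
    proof
      show "(\<Union>n. ?A (Suc n)) \<subseteq> (\<Union>n. ?A n)" by (intro UN_least UN_upper UNIV_I)
      show "(\<Union>n. ?A n) \<subseteq> (\<Union>n. ?A (Suc n))" by (rule UN_mono[OF subset_refl step])
    qed
    finally show ?thesis .
  qed
  moreover have "(\<Union>n. ?A n) \<in> sets P"
    using sets by (intro sets.countable_UN) auto
  ultimately show ?thesis
    using ergodic[of "\<Union>n. ?A n"] by simp
qed

text \<open>For \<open>d\<close> below the essential supremum, the set where \<open>d < f\<close> is
  mapped into itself and is not null, so it has full measure. Letting \<open>d\<close> run through
  the rationals shows that \<open>f\<close> equals its essential supremum a.e.\<close>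

lemma subinvariant_AE_const:
  fixes f :: "'w \<Rightarrow> ereal"
  assumes f[measurable]: "f \<in> borel_measurable P"
    and sub: "\<And>\<omega>. \<omega> \<in> space P \<Longrightarrow> f \<omega> \<le> f (\<theta> \<omega>)"
  obtains c where "AE \<omega> in P. f \<omega> = c"
proof
  let ?c = "esssup P f"
  have "AE \<omega> in P. d < f \<omega>" if "d < ?c" for d
  proof -
    let ?A = "{\<omega>\<in>space P. d < f \<omega>}"
    have "prob ?A = 0 \<or> prob ?A = 1"
      using sub measurable_space[OF measurable_base]
      by (intro prob_subinvariant_0_or_1) (auto intro: less_le_trans)
    moreover have "prob ?A \<noteq> 0"
    proof
      assume "prob ?A = 0"
      then have "AE \<omega> in P. f \<omega> \<le> d"
        by (subst (asm) prob_eq_0) (auto simp: not_less)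
      then show False
        using leD[OF esssup_I[OF f]] that by blast
    qed
    ultimately show ?thesis
      by (simp add: prob_Collect_eq_1)
  qed
  then have "AE \<omega> in P. \<forall>q::rat. ereal (of_rat q) < ?c \<longrightarrow> ereal (of_rat q) < f \<omega>"
    by (subst AE_all_countable) (auto intro!: AE_impI)
  then show "AE \<omega> in P. f \<omega> = ?c"
    using esssup_AE[where M = P and f = f]
  proof eventually_elim
    case (elim \<omega>)
    have "\<not> f \<omega> < ?c"
    proof
      assume "f \<omega> < ?c"
      then obtain q :: rat where "f \<omega> < real_of_rat q" "real_of_rat q < ?c"
        using ereal_dense3 by blast
      with elim(1) show False by fastforce
    qed
    with elim(2) show ?case by simp
  qed
qed

end

text \<open>The inequalities are required at every point of the space, so that each orbit can be cut
  into blocks; null sets enter only through limits in \<open>n\<close>.\<close>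

locale bounded_subadditive_process = ergodic_automorphism P \<theta>
  for P :: "'w measure" and \<theta> :: "'w \<Rightarrow> 'w" +
  fixes a :: "nat \<Rightarrow> 'w \<Rightarrow> real" and C :: real
  assumes measurable_process[measurable]: "a n \<in> borel_measurable P"
    and nonneg: "\<omega> \<in> space P \<Longrightarrow> 0 \<le> a n \<omega>"
    and bounded: "\<omega> \<in> space P \<Longrightarrow> a n \<omega> \<le> C * real n"
    and subadditive: "\<omega> \<in> space P \<Longrightarrow> a (m + n) \<omega> \<le> a m \<omega> + a n ((\<theta> ^^ m) \<omega>)"
begin

lemma C_nonneg: "0 \<le> C"
proof -
  obtain \<omega> where "\<omega> \<in> space P" using not_empty by blast
  then show ?thesis using nonneg[of \<omega> 1] bounded[of \<omega> 1] by simp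
qed

text \<open>Removing the first step costs at most \<open>C\<close>, which vanishes after division by
  \<open>n\<close>. So the lower rate does not decrease along \<open>\<theta>\<close> and is a.e.
  constant; the bounds on the process make it finite.\<close>

lemma liminf_AE_const:
  obtains g :: real where "0 \<le> g" "AE \<omega> in P. liminf (\<lambda>n. ereal (a n \<omega> / real n)) = ereal g"
proof -
  let ?f = "\<lambda>\<omega>. liminf (\<lambda>n. ereal (a n \<omega> / real n))"
  have mono: "?f \<omega> \<le> ?f (\<theta> \<omega>)" if \<omega>: "\<omega> \<in> space P" for \<omega>
  proof -
    have "?f \<omega> = liminf (\<lambda>n. ereal (a (Suc n) \<omega> / real (Suc n)))"
      using liminf_shift[of "\<lambda>n. ereal (a n \<omega> / real n)"] by simp
    also have "\<dots> \<le> liminf (\<lambda>n. ereal (C / real (Suc n)) + ereal (a n (\<theta> \<omega>) / real n))"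
    proof (rule Liminf_mono, rule eventually_mono[OF eventually_gt_at_top[of 0]])
      fix n :: nat assume "0 < n"
      have "a (Suc n) \<omega> \<le> C + a n (\<theta> \<omega>)"
        using subadditive[OF \<omega>, of 1 n] bounded[OF \<omega>, of 1] by simp
      then have "a (Suc n) \<omega> / real (Suc n) \<le> C / real (Suc n) + a n (\<theta> \<omega>) / real (Suc n)"
        by (simp add: divide_right_mono flip: add_divide_distrib)
      also have "a n (\<theta> \<omega>) / real (Suc n) \<le> a n (\<theta> \<omega>) / real n"
        using \<open>0 < n\<close> nonneg[of "\<theta> \<omega>" n] measurable_space[OF measurable_base \<omega>]
        by (intro divide_left_mono) auto
      finally show "ereal (a (Suc n) \<omega> / real (Suc n))
          \<le> ereal (C / real (Suc n)) + ereal (a n (\<theta> \<omega>) / real n)"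
        by simp
    qed
    also have "\<dots> = 0 + ?f (\<theta> \<omega>)"
    proof (rule ereal_liminf_lim_add)
      have "(\<lambda>n. C / real (Suc n)) \<longlonglongrightarrow> 0"
        using LIMSEQ_Suc[OF lim_const_over_n[of C]] by simp
      then show "(\<lambda>n. ereal (C / real (Suc n))) \<longlonglongrightarrow> 0"
        by (simp add: zero_ereal_def)
    qed simp
    finally show ?thesis by simp
  qed
  have "?f \<in> borel_measurable P" by measurable
  from subinvariant_AE_const[OF this mono] obtain c where c: "AE \<omega> in P. ?f \<omega> = c"
    by blast
  have "AE \<omega> in P. 0 \<le> ?f \<omega> \<and> ?f \<omega> \<le> ereal C"
  proof (rule AE_I2)
    fix \<omega> assume \<omega>: "\<omega> \<in> space P"
    have "0 \<le> ?f \<omega>"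
      using nonneg[OF \<omega>] by (intro Liminf_bounded) simp
    moreover have "?f \<omega> \<le> liminf (\<lambda>n. ereal C)"
      using bounded[OF \<omega>]
      by (intro Liminf_mono eventually_mono[OF eventually_gt_at_top[of 0]]) (simp add: field_simps)
    ultimately show "0 \<le> ?f \<omega> \<and> ?f \<omega> \<le> ereal C"
      by (simp add: Liminf_const)
  qed
  with c have "AE \<omega> in P. 0 \<le> c \<and> c \<le> ereal C"
    by eventually_elim simp
  then have "0 \<le> c" "c \<le> ereal C" by simp_all
  then obtain g where "c = ereal g" "0 \<le> g" by (cases c) auto
  with c that show ?thesis by blast
qed

text \<open>\<open>B N\<close> collects the points without a block of length at most
  \<open>N\<close> and average at most \<open>g + \<epsilon>\<close>. Where the liminf equals
  \<open>g\<close> such a block exists for some \<open>N\<close>, so the sets \<open>B N\<close>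
  decrease to a null set. The greedy bound is then applied along each orbit.\<close>

lemma covering_bound:
  assumes g: "AE \<omega> in P. liminf (\<lambda>n. ereal (a n \<omega> / real n)) = ereal g" and "0 \<le> g" "0 < \<epsilon>"
  obtains B N where "B \<in> sets P" "prob B < \<epsilon>"
    "\<And>\<omega> n. \<omega> \<in> space P \<Longrightarrow>
       a n \<omega> \<le> (g + \<epsilon>) * real n + C * (\<Sum>i<n. indicator B ((\<theta> ^^ i) \<omega>)) + C * real N"
proof -
  define B where "B N = {\<omega>\<in>space P. \<forall>l\<in>{1..N}. (g + \<epsilon>) * real l < a l \<omega>}" for N
  have B[measurable]: "B N \<in> sets P" for N
    unfolding B_def by measurable
  have "decseq B"
    by (rule decseq_SucI) (auto simp: B_def)
  then have "(\<lambda>N. prob (B N)) \<longlonglongrightarrow> prob (\<Inter>N. B N)"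
    by (intro finite_Lim_measure_decseq) auto
  moreover have "prob (\<Inter>N. B N) = 0"
  proof -
    from g have "AE \<omega> in P. \<omega> \<notin> (\<Inter>N. B N)"
    proof eventually_elim
      case (elim \<omega>)
      have "\<not> (\<forall>y<ereal (g + \<epsilon>). \<forall>\<^sub>F n in sequentially. y < ereal (a n \<omega> / real n))"
        using \<open>0 < \<epsilon>\<close> elim le_Liminf_iff[of "ereal (g + \<epsilon>)" sequentially "\<lambda>n. ereal (a n \<omega> / real n)"]
        by auto
      then obtain y where y: "y < ereal (g + \<epsilon>)" "\<exists>\<^sub>F n in sequentially. ereal (a n \<omega> / real n) \<le> y"
        by (auto simp: frequently_def not_le)
      then obtain n where "1 \<le> n" "ereal (a n \<omega> / real n) \<le> y"
        using frequently_eventually_frequently[OF y(2) eventually_ge_at_top[of 1]]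
        by (auto dest: frequently_ex)
      then have "ereal (a n \<omega> / real n) < ereal (g + \<epsilon>)"
        using y(1) by (metis le_less_trans)
      then have "a n \<omega> \<le> (g + \<epsilon>) * real n"
        using \<open>1 \<le> n\<close> by (simp add: divide_less_eq)
      then have "\<omega> \<notin> B n"
        using \<open>1 \<le> n\<close> by (auto simp: B_def intro!: bexI[of _ n])
      then show ?case by blast
    qed
    then show ?thesis
      by (subst prob_eq_0) auto
  qed
  ultimately have "\<forall>\<^sub>F N in sequentially. prob (B N) < \<epsilon>"
    using \<open>0 < \<epsilon>\<close> by (intro order_tendstoD) auto
  then obtain N where N: "prob (B N) < \<epsilon>"
    by (auto dest: eventually_happens)
  show ?thesis
  proof
    fix \<omega> n assume \<omega>: "\<omega> \<in> space P"
    let ?B = "{k. (\<theta> ^^ k) \<omega> \<in> B N}"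
    have "a n ((\<theta> ^^ 0) \<omega>) \<le> (g + \<epsilon>) * real n + C * (\<Sum>i<n. indicator ?B (0 + i)) + C * real N"
    proof (rule greedy_subadditive_bound)
      fix k m n
      show "a (m + n) ((\<theta> ^^ k) \<omega>) \<le> a m ((\<theta> ^^ k) \<omega>) + a n ((\<theta> ^^ (k + m)) \<omega>)"
        using subadditive[OF funpow_space[OF \<omega>, of k], of m n]
        by (simp add: funpow_add add.commute[of k])
      show "a n ((\<theta> ^^ k) \<omega>) \<le> C * real n"
        using bounded[OF funpow_space[OF \<omega>]] .
    next
      fix k assume "k \<notin> ?B"
      then show "\<exists>l\<in>{1..N}. a l ((\<theta> ^^ k) \<omega>) \<le> (g + \<epsilon>) * real l"
        using funpow_space[OF \<omega>, of k] by (auto simp: B_def not_less)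
    qed (use C_nonneg \<open>0 \<le> g\<close> \<open>0 < \<epsilon>\<close> in auto)
    moreover have "indicator ?B i = (indicator (B N) ((\<theta> ^^ i) \<omega>) :: real)" for i
      by (simp add: indicator_def)
    ultimately show "a n \<omega> \<le> (g + \<epsilon>) * real n + C * (\<Sum>i<n. indicator (B N) ((\<theta> ^^ i) \<omega>)) + C * real N"
      by simp
  qed (use N in auto)
qed

end

section \<open>Frequency of visits to a measurable set\<close>

context ergodic_automorphism
begin

lemma integral_visits:
  assumes [measurable]: "D \<in> sets P"
  shows "integrable P (\<lambda>\<omega>. \<Sum>i<n. indicator D ((\<theta> ^^ i) \<omega>) :: real)"
    and "(\<integral>\<omega>. (\<Sum>i<n. indicator D ((\<theta> ^^ i) \<omega>)) \<partial>P) = real n * prob D"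
proof -
  note funpow_measurable[measurable]
  have int: "integrable P (\<lambda>\<omega>. indicator D ((\<theta> ^^ i) \<omega>) :: real)" for i
    by (rule integrable_const_bound[where B = 1]) (auto simp: indicator_def)
  then show "integrable P (\<lambda>\<omega>. \<Sum>i<n. indicator D ((\<theta> ^^ i) \<omega>) :: real)"
    by (rule Bochner_Integration.integrable_sum)
  have "(\<integral>\<omega>. indicator D ((\<theta> ^^ i) \<omega>) \<partial>P) = prob D" for i
  proof -
    have "(\<integral>\<omega>. indicator D ((\<theta> ^^ i) \<omega>) \<partial>P) = (\<integral>\<omega>. indicator D \<omega> \<partial>distr P P (\<theta> ^^ i) :: real)"
      by (rule integral_distr[symmetric, OF funpow_measurable]) simp
    then show ?thesis by (simp add: distr_funpow)
  qed
  then show "(\<integral>\<omega>. (\<Sum>i<n. indicator D ((\<theta> ^^ i) \<omega>)) \<partial>P) = real n * prob D"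
    using int by (simp add: Bochner_Integration.integral_sum)
qed

lemma visits_process:
  assumes [measurable]: "D \<in> sets P"
  shows "bounded_subadditive_process P \<theta> (\<lambda>n \<omega>. \<Sum>i<n. indicator D ((\<theta> ^^ i) \<omega>)) 1"
proof unfold_locales
  fix n m and \<omega>
  note funpow_measurable[measurable]
  show "(\<lambda>\<omega>. \<Sum>i<n. indicator D ((\<theta> ^^ i) \<omega>) :: real) \<in> borel_measurable P"
    by measurable
  show "0 \<le> (\<Sum>i<n. indicator D ((\<theta> ^^ i) \<omega>) :: real)"
    by (simp add: sum_nonneg)
  have "(\<Sum>i<n. indicator D ((\<theta> ^^ i) \<omega>) :: real) \<le> (\<Sum>i<n. 1)"
    by (rule sum_mono) (simp add: indicator_def)
  then show "(\<Sum>i<n. indicator D ((\<theta> ^^ i) \<omega>) :: real) \<le> 1 * real n"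
    by simp
  show "(\<Sum>i<m + n. indicator D ((\<theta> ^^ i) \<omega>) :: real)
      \<le> (\<Sum>i<m. indicator D ((\<theta> ^^ i) \<omega>)) + (\<Sum>i<n. indicator D ((\<theta> ^^ i) ((\<theta> ^^ m) \<omega>)))"
    unfolding sum_lessThan_add by (simp add: add.commute[of m] funpow_add)
qed

text \<open>Integrating the covering bound for the process of visits to \<open>D\<close> shows that its a.e. constant
  lower growth rate cannot be less than \<open>prob D\<close>.\<close>

lemma AE_liminf_visits_ge:
  assumes D[measurable]: "D \<in> sets P"
  shows "AE \<omega> in P. ereal (prob D) \<le> liminf (\<lambda>n. ereal ((\<Sum>i<n. indicator D ((\<theta> ^^ i) \<omega>)) / real n))"
proof -
  interpret D: bounded_subadditive_process P \<theta> "\<lambda>n \<omega>. \<Sum>i<n. indicator D ((\<theta> ^^ i) \<omega>)" 1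
    by (rule visits_process) fact
  obtain g where g: "0 \<le> g"
    "AE \<omega> in P. liminf (\<lambda>n. ereal ((\<Sum>i<n. indicator D ((\<theta> ^^ i) \<omega>)) / real n)) = ereal g"
    by (rule D.liminf_AE_const)
  have "prob D \<le> g"
  proof (rule field_le_epsilon)
    fix e :: real assume "0 < e"
    \<comment> \<open>One half of \<open>e\<close> pays for the excess over \<open>g\<close>, the
      other for the measure of \<open>B\<close>.\<close>
    define \<epsilon> where "\<epsilon> = e / 2"
    have "0 < \<epsilon>" using \<open>0 < e\<close> by (simp add: \<epsilon>_def)
    obtain B N where B[measurable]: "B \<in> sets P" and "prob B < \<epsilon>" and
      le: "\<And>\<omega> n. \<omega> \<in> space P \<Longrightarrow> (\<Sum>i<n. indicator D ((\<theta> ^^ i) \<omega>)) \<le>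
         (g + \<epsilon>) * real n + 1 * (\<Sum>i<n. indicator B ((\<theta> ^^ i) \<omega>)) + 1 * real N"
      using D.covering_bound[OF g(2,1) \<open>0 < \<epsilon>\<close>] by blast
    \<comment> \<open>\<open>B\<close> and \<open>N\<close> do not depend on \<open>n\<close>, so
      the last term disappears as \<open>n\<close> grows.\<close>
    have "prob D \<le> g + e + real N / real n" if "0 < n" for n
    proof -
      have "real n * prob D = (\<integral>\<omega>. (\<Sum>i<n. indicator D ((\<theta> ^^ i) \<omega>)) \<partial>P)"
        by (simp add: integral_visits)
      also have "\<dots> \<le> (\<integral>\<omega>. ((g + \<epsilon>) * real n + real N) + (\<Sum>i<n. indicator B ((\<theta> ^^ i) \<omega>)) \<partial>P)"
        using le by (intro integral_mono Bochner_Integration.integrable_add integral_visits)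
          (auto simp: algebra_simps)
      also have "\<dots> = ((g + \<epsilon>) * real n + real N) + real n * prob B"
        by (subst Bochner_Integration.integral_add) (auto simp: integral_visits prob_space)
      also have "\<dots> \<le> ((g + \<epsilon>) * real n + real N) + real n * \<epsilon>"
        using \<open>prob B < \<epsilon>\<close> by (simp add: mult_left_mono)
      also have "\<dots> = real n * (g + e + real N / real n)"
        using that by (simp add: \<epsilon>_def field_simps)
      finally show ?thesis using that by simp
    qed
    then have "\<forall>\<^sub>F n in sequentially. prob D \<le> g + e + real N / real n"
      using eventually_gt_at_top[of 0] by (rule eventually_mono[rotated])
    moreover have "(\<lambda>n. g + e + real N / real n) \<longlonglongrightarrow> g + e + 0"
      by (intro tendsto_intros lim_const_over_n)
    ultimately show "prob D \<le> g + e"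
      using tendsto_lowerbound[of "\<lambda>n. g + e + real N / real n" "g + e + 0" sequentially "prob D"]
      by simp
  qed
  then show ?thesis
    by (intro eventually_mono[OF g(2)]) simp
qed

text \<open>Visits to \<open>B\<close> and to its complement add up to \<open>n\<close>, so the
  lower bound for the complement is an upper bound for \<open>B\<close>. The gap between
  \<open>prob B\<close> and \<open>\<epsilon>\<close> allows the passage from the liminf to all
  large \<open>n\<close>.\<close>

lemma AE_visits_eventually_le:
  assumes B[measurable]: "B \<in> sets P" and "prob B < \<epsilon>"
  shows "AE \<omega> in P. \<forall>\<^sub>F n in sequentially. (\<Sum>i<n. indicator B ((\<theta> ^^ i) \<omega>)) \<le> \<epsilon> * real n"
proof -
  let ?D = "space P - B"
  have "AE \<omega> in P. ereal (prob ?D) \<le> liminf (\<lambda>n. ereal ((\<Sum>i<n. indicator ?D ((\<theta> ^^ i) \<omega>)) / real n))"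
    by (rule AE_liminf_visits_ge) auto
  then show ?thesis
    using AE_space
  proof eventually_elim
    case (elim \<omega>)
    have "ereal (1 - \<epsilon>) < ereal (prob ?D)"
      using \<open>prob B < \<epsilon>\<close> by (simp add: prob_compl)
    with elim(1) have "\<forall>\<^sub>F n in sequentially. ereal (1 - \<epsilon>) < ereal ((\<Sum>i<n. indicator ?D ((\<theta> ^^ i) \<omega>)) / real n)"
      unfolding le_Liminf_iff by blast
    then show ?case
      using eventually_gt_at_top[of 0]
    proof eventually_elim
      case (elim n)
      have "indicator ?D ((\<theta> ^^ i) \<omega>) = 1 - (indicator B ((\<theta> ^^ i) \<omega>) :: real)" for i
        using funpow_space[OF \<open>\<omega> \<in> space P\<close>, of i] by (simp add: indicator_def)
      with elim show ?case
        by (simp add: sum_subtractf field_simps)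
    qed
  qed
qed

end

text \<open>Once the visits to the bad set number at most \<open>\<epsilon> * real n\<close>, the
  covering bound gives a limsup of at most \<open>g + (1 + C) * \<epsilon>\<close>. The null set
  depends on \<open>\<epsilon>\<close>, hence the sequence \<open>1 / real (Suc k)\<close>.\<close>

theorem (in bounded_subadditive_process) AE_limsup_eq_liminf:
  "AE \<omega> in P. limsup (\<lambda>n. ereal (a n \<omega> / real n)) = liminf (\<lambda>n. ereal (a n \<omega> / real n))"
proof -
  obtain g where g: "0 \<le> g" "AE \<omega> in P. liminf (\<lambda>n. ereal (a n \<omega> / real n)) = ereal g"
    by (rule liminf_AE_const)
  have limsup: "AE \<omega> in P. limsup (\<lambda>n. ereal (a n \<omega> / real n)) \<le> ereal (g + (1 + C) * \<epsilon>)" if "0 < \<epsilon>" for \<epsilon>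
  proof -
    obtain B N where B[measurable]: "B \<in> sets P" and "prob B < \<epsilon>" and
      le: "\<And>\<omega> n. \<omega> \<in> space P \<Longrightarrow>
         a n \<omega> \<le> (g + \<epsilon>) * real n + C * (\<Sum>i<n. indicator B ((\<theta> ^^ i) \<omega>)) + C * real N"
      using covering_bound[OF g(2,1) \<open>0 < \<epsilon>\<close>] by blast
    from AE_visits_eventually_le[OF B \<open>prob B < \<epsilon>\<close>] AE_space show ?thesis
    proof eventually_elim
      case (elim \<omega>)
      have "\<forall>\<^sub>F n in sequentially. ereal (a n \<omega> / real n) \<le> ereal (g + (1 + C) * \<epsilon> + C * real N / real n)"
        using elim(1) eventually_gt_at_top[of 0]
      proof eventually_elim
        case (elim n)
        have "C * (\<Sum>i<n. indicator B ((\<theta> ^^ i) \<omega>)) \<le> C * (\<epsilon> * real n)"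
          using C_nonneg elim(1) by (intro mult_left_mono) auto
        then have "a n \<omega> \<le> (g + \<epsilon>) * real n + C * (\<epsilon> * real n) + C * real N"
          using le[OF \<open>\<omega> \<in> space P\<close>, of n] by simp
        then show ?case
          using \<open>0 < n\<close> by (simp add: field_simps)
      qed
      then have "limsup (\<lambda>n. ereal (a n \<omega> / real n))
          \<le> limsup (\<lambda>n. ereal (g + (1 + C) * \<epsilon> + C * real N / real n))"
        by (rule Limsup_mono)
      also have "\<dots> = ereal (g + (1 + C) * \<epsilon> + 0)"
        by (intro lim_imp_Limsup tendsto_ereal tendsto_intros lim_const_over_n) auto
      finally show ?case by simp
    qed
  qed
  have "AE \<omega> in P. \<forall>k. limsup (\<lambda>n. ereal (a n \<omega> / real n)) \<le> ereal (g + (1 + C) * (1 / real (Suc k)))"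
    unfolding AE_all_countable by (intro allI limsup) simp
  with g(2) show ?thesis
  proof eventually_elim
    case (elim \<omega>)
    have "(\<lambda>k. g + (1 + C) * (1 / real (Suc k))) \<longlonglongrightarrow> g + (1 + C) * 0"
      by (intro tendsto_intros LIMSEQ_Suc[OF lim_const_over_n])
    then have "(\<lambda>k. ereal (g + (1 + C) * (1 / real (Suc k)))) \<longlonglongrightarrow> ereal g"
      by simp
    then have "limsup (\<lambda>n. ereal (a n \<omega> / real n)) \<le> ereal g"
      by (rule LIMSEQ_le_const) (use elim(2) in blast)
    with elim(1) show ?case
      using Liminf_le_Limsup[of sequentially "\<lambda>n. ereal (a n \<omega> / real n)"] by (intro antisym) auto
  qed
qed

section \<open>Word covers and the fiber entropy\<close>

lemma rds_iter_add:
  "rds_iter \<theta> T (m + n) \<omega> x = rds_iter \<theta> T n ((\<theta> ^^ m) \<omega>) (rds_iter \<theta> T m \<omega> x)"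
proof (induction n)
  case (Suc n)
  have "(\<theta> ^^ (m + n)) \<omega> = (\<theta> ^^ n) ((\<theta> ^^ m) \<omega>)"
    by (simp add: add.commute[of m] funpow_add)
  with Suc show ?case by simp
qed simp

definition words :: "'x set \<Rightarrow> nat \<Rightarrow> 'x list set" where
  "words Q n = {w. set w \<subseteq> Q \<and> length w = n}"

definition word_cover ::
  "('w \<Rightarrow> 'w) \<Rightarrow> ('w \<Rightarrow> 'x::metric_space \<Rightarrow> 'x) \<Rightarrow> real \<Rightarrow> nat \<Rightarrow> 'w \<Rightarrow> 'x list set \<Rightarrow> bool" where
  "word_cover \<theta> T \<delta> n \<omega> W \<longleftrightarrow> (\<forall>x. \<exists>w\<in>W. \<forall>i<n. dist (rds_iter \<theta> T i \<omega> x) (w ! i) \<le> \<delta>)"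

text \<open>The closed balls around the points of \<open>Q\<close> play the role of the open cover in the definition of
  entropy by covers. Closedness makes the covering property testable on a countable dense set, hence
  measurable in \<open>\<omega>\<close>.\<close>

definition word_number ::
  "('w \<Rightarrow> 'w) \<Rightarrow> ('w \<Rightarrow> 'x::metric_space \<Rightarrow> 'x) \<Rightarrow> 'x set \<Rightarrow> real \<Rightarrow> nat \<Rightarrow> 'w \<Rightarrow> nat" where
  "word_number \<theta> T Q \<delta> n \<omega> = (LEAST k. \<exists>W\<in>Pow (words Q n). word_cover \<theta> T \<delta> n \<omega> W \<and> card W = k)"

lemma finite_words: "finite Q \<Longrightarrow> finite (words Q n)"
  unfolding words_def by (rule finite_lists_length_eq)

lemma card_words: "finite Q \<Longrightarrow> card (words Q n) = card Q ^ n"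
  unfolding words_def by (rule card_lists_length_eq)

lemma word_number_le:
  "W \<subseteq> words Q n \<Longrightarrow> word_cover \<theta> T \<delta> n \<omega> W \<Longrightarrow> word_number \<theta> T Q \<delta> n \<omega> \<le> card W"
  unfolding word_number_def by (rule Least_le) blast

context
  fixes \<theta> :: "'w \<Rightarrow> 'w" and T :: "'w \<Rightarrow> 'x::metric_space \<Rightarrow> 'x" and Q :: "'x set" and \<delta> :: real
  assumes finite_Q: "finite Q" and net: "\<And>x. \<exists>q\<in>Q. dist x q \<le> \<delta> / 2"
begin

lemma delta_nonneg: "0 \<le> \<delta>"
proof -
  obtain q where "dist (undefined :: 'x) q \<le> \<delta> / 2" using net by blast
  then have "0 \<le> \<delta> / 2" by (rule order_trans[OF zero_le_dist])
  then show ?thesis by simp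
qed

text \<open>Words follow orbits within half the radius allowed by \<open>word_cover\<close>. The
  other half is spent on passing from a point to a nearby spanning point.\<close>

lemma itinerary_exists:
  obtains w where "w \<in> words Q n" "\<forall>i<n. dist (rds_iter \<theta> T i \<omega> x) (w ! i) \<le> \<delta> / 2"
proof -
  obtain c where c: "\<And>z. c z \<in> Q" "\<And>z. dist z (c z) \<le> \<delta> / 2"
    using net by metis
  show ?thesis
    by (rule that[of "map (\<lambda>i. c (rds_iter \<theta> T i \<omega> x)) [0..<n]"]) (use c in \<open>auto simp: words_def\<close>)
qed

lemma word_cover_words: "word_cover \<theta> T \<delta> n \<omega> (words Q n)"
  unfolding word_cover_def
proof
  fix x
  obtain w where w: "w \<in> words Q n" "\<forall>i<n. dist (rds_iter \<theta> T i \<omega> x) (w ! i) \<le> \<delta> / 2"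
    by (rule itinerary_exists)
  have "dist (rds_iter \<theta> T i \<omega> x) (w ! i) \<le> \<delta>" if "i < n" for i
    using w(2)[rule_format, OF that] delta_nonneg by simp
  with w(1) show "\<exists>w\<in>words Q n. \<forall>i<n. dist (rds_iter \<theta> T i \<omega> x) (w ! i) \<le> \<delta>"
    by blast
qed

lemma word_number_attained:
  obtains W where "W \<subseteq> words Q n" "finite W" "word_cover \<theta> T \<delta> n \<omega> W" "card W = word_number \<theta> T Q \<delta> n \<omega>"
proof -
  have "\<exists>W\<in>Pow (words Q n). word_cover \<theta> T \<delta> n \<omega> W \<and> card W = word_number \<theta> T Q \<delta> n \<omega>"
    unfolding word_number_def
    by (rule LeastI[of _ "card (words Q n)"]) (use word_cover_words in blast)
  then show ?thesis
    using that finite_subset[OF _ finite_words[OF finite_Q]] by blast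
qed

lemma word_number_pos: "0 < word_number \<theta> T Q \<delta> n \<omega>"
proof -
  obtain W where "finite W" "word_cover \<theta> T \<delta> n \<omega> W" "card W = word_number \<theta> T Q \<delta> n \<omega>"
    by (rule word_number_attained)
  moreover from this(2) have "W \<noteq> {}" by (auto simp: word_cover_def)
  ultimately show ?thesis by (metis card_gt_0_iff)
qed

lemma word_number_le_power: "word_number \<theta> T Q \<delta> n \<omega> \<le> card Q ^ n"
  using word_number_le[OF subset_refl word_cover_words] card_words[OF finite_Q] by metis

text \<open>Words are concatenated. The second cover serves every point of the space, in particular
  the position of the orbit at time \<open>m\<close>. The same argument with spanning sets would
  double the scale, hence the detour through words.\<close>

lemma word_number_submultiplicative:
  "word_number \<theta> T Q \<delta> (m + n) \<omega> \<le> word_number \<theta> T Q \<delta> m \<omega> * word_number \<theta> T Q \<delta> n ((\<theta> ^^ m) \<omega>)"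
proof -
  obtain V where V: "V \<subseteq> words Q m" "finite V" "word_cover \<theta> T \<delta> m \<omega> V" "card V = word_number \<theta> T Q \<delta> m \<omega>"
    by (rule word_number_attained)
  obtain W where W: "W \<subseteq> words Q n" "finite W" "word_cover \<theta> T \<delta> n ((\<theta> ^^ m) \<omega>) W"
    "card W = word_number \<theta> T Q \<delta> n ((\<theta> ^^ m) \<omega>)"
    by (rule word_number_attained)
  let ?U = "(\<lambda>(v, w). v @ w) ` (V \<times> W)"
  have "?U \<subseteq> words Q (m + n)"
    using V(1) W(1) by (auto simp: words_def subset_iff)
  moreover have "word_cover \<theta> T \<delta> (m + n) \<omega> ?U"
    unfolding word_cover_def
  proof
    fix x
    obtain v where v: "v \<in> V" "\<forall>i<m. dist (rds_iter \<theta> T i \<omega> x) (v ! i) \<le> \<delta>"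
      using V(3) unfolding word_cover_def by blast
    obtain w where w: "w \<in> W"
      "\<forall>i<n. dist (rds_iter \<theta> T i ((\<theta> ^^ m) \<omega>) (rds_iter \<theta> T m \<omega> x)) (w ! i) \<le> \<delta>"
      using W(3) unfolding word_cover_def by blast
    have "length v = m" using v(1) V(1) by (auto simp: words_def)
    have "dist (rds_iter \<theta> T i \<omega> x) ((v @ w) ! i) \<le> \<delta>" if "i < m + n" for i
    proof (cases "i < m")
      case True
      then show ?thesis using v(2) \<open>length v = m\<close> by (simp add: nth_append)
    next
      case False
      then have "rds_iter \<theta> T i \<omega> x = rds_iter \<theta> T (i - m) ((\<theta> ^^ m) \<omega>) (rds_iter \<theta> T m \<omega> x)"
        using rds_iter_add[of \<theta> T m "i - m"] by simp
      then show ?thesis using w(2) False that \<open>length v = m\<close> by (simp add: nth_append)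
    qed
    then show "\<exists>u\<in>?U. \<forall>i<m + n. dist (rds_iter \<theta> T i \<omega> x) (u ! i) \<le> \<delta>"
      using v(1) w(1) by blast
  qed
  ultimately have "word_number \<theta> T Q \<delta> (m + n) \<omega> \<le> card ?U"
    by (rule word_number_le)
  also have "\<dots> \<le> card V * card W"
    using card_image_le[of "V \<times> W"] V(2) W(2) by (simp add: card_cartesian_product)
  finally show ?thesis unfolding V(4) W(4) .
qed

text \<open>Orbits following the same word stay within \<open>2 * \<delta>\<close> of each other.
  With \<open>word_number_le_span_number\<close> this encloses the word numbers between Bowen
  numbers at two scales.\<close>

lemma span_number_le_word_number:
  assumes "0 < n"
  shows "span_number (bowen_dist \<theta> T \<omega> n) (2 * \<delta>) \<le> enat (word_number \<theta> T Q \<delta> n \<omega>)"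
proof -
  obtain W where W: "W \<subseteq> words Q n" "finite W" "word_cover \<theta> T \<delta> n \<omega> W" "card W = word_number \<theta> T Q \<delta> n \<omega>"
    by (rule word_number_attained)
  let ?A = "\<lambda>w. {x. \<forall>i<n. dist (rds_iter \<theta> T i \<omega> x) (w ! i) \<le> \<delta>}"
  have "span_number (bowen_dist \<theta> T \<omega> n) (2 * \<delta>) \<le> enat (card W)"
  proof (rule span_number_le_card_cover[where A = ?A])
    show "\<exists>w\<in>W. x \<in> ?A w" for x
      using W(3) unfolding word_cover_def by blast
    fix w x y assume xy: "x \<in> ?A w" "y \<in> ?A w"
    show "bowen_dist \<theta> T \<omega> n x y \<le> 2 * \<delta>"
    proof (rule bowen_dist_le[OF assms])
      fix i assume "i < n"
      with xy have "dist (rds_iter \<theta> T i \<omega> x) (w ! i) \<le> \<delta>" "dist (rds_iter \<theta> T i \<omega> y) (w ! i) \<le> \<delta>"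
        by auto
      then show "dist (rds_iter \<theta> T i \<omega> x) (rds_iter \<theta> T i \<omega> y) \<le> 2 * \<delta>"
        using dist_triangle2[of "rds_iter \<theta> T i \<omega> x" "rds_iter \<theta> T i \<omega> y" "w ! i"] by linarith
    qed
  qed fact
  then show ?thesis unfolding W(4) .
qed

text \<open>Coding the orbits of a spanning set by words yields a cover, by the triangle inequality
  through the spanning point.\<close>

lemma word_number_le_span_number:
  "enat (word_number \<theta> T Q \<delta> n \<omega>) \<le> span_number (bowen_dist \<theta> T \<omega> n) (\<delta> / 2)"
  unfolding span_number_def
proof (rule Inf_greatest, clarify)
  fix E assume E: "finite E" "spanning (bowen_dist \<theta> T \<omega> n) (\<delta> / 2) E"
  have "\<exists>w\<in>words Q n. \<forall>i<n. dist (rds_iter \<theta> T i \<omega> y) (w ! i) \<le> \<delta> / 2" for y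
    by (rule itinerary_exists) blast
  then obtain w where w: "\<And>y. w y \<in> words Q n" "\<And>y. \<forall>i<n. dist (rds_iter \<theta> T i \<omega> y) (w y ! i) \<le> \<delta> / 2"
    by metis
  have "word_cover \<theta> T \<delta> n \<omega> (w ` E)"
    unfolding word_cover_def
  proof
    fix x
    obtain y where y: "y \<in> E" "bowen_dist \<theta> T \<omega> n x y \<le> \<delta> / 2"
      using E(2) unfolding spanning_def by blast
    have "dist (rds_iter \<theta> T i \<omega> x) (w y ! i) \<le> \<delta>" if "i < n" for i
      using dist_le_bowen_dist[OF that, of \<theta> T \<omega> x y] y(2) w(2)[rule_format, OF that, of y]
        dist_triangle[of "rds_iter \<theta> T i \<omega> x" "w y ! i" "rds_iter \<theta> T i \<omega> y"] by linarith
    with y(1) show "\<exists>w\<in>w ` E. \<forall>i<n. dist (rds_iter \<theta> T i \<omega> x) (w ! i) \<le> \<delta>"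
      by blast
  qed
  then have "word_number \<theta> T Q \<delta> n \<omega> \<le> card (w ` E)"
    using w(1) by (intro word_number_le) auto
  also have "\<dots> \<le> card E"
    using E(1) by (rule card_image_le)
  finally show "enat (word_number \<theta> T Q \<delta> n \<omega>) \<le> enat (card E)" by simp
qed

end

lemma compact_UNIV_countable_dense:
  assumes "compact (UNIV :: 'x::metric_space set)"
  obtains S :: "'x::metric_space set" where "countable S" "closure S = UNIV"
proof -
  have "\<exists>Q :: 'x set. finite Q \<and> (\<forall>x. \<exists>q\<in>Q. dist x q < 1 / real (Suc k))" for k
    using compact_UNIV_finite_net[OF assms, of "1 / real (Suc k)"]
    by (metis of_nat_0_less_iff zero_less_Suc zero_less_divide_1_iff)
  then obtain Q :: "nat \<Rightarrow> 'x set" where Q: "\<And>k. finite (Q k)" "\<And>k x. \<exists>q\<in>Q k. dist x q < 1 / real (Suc k)"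
    by metis
  show ?thesis
  proof
    show "countable (\<Union>k. Q k)" using Q(1) by (auto intro: countable_finite)
    have "x \<in> closure (\<Union>k. Q k)" for x
      unfolding closure_approachable
    proof (intro allI impI)
      fix e :: real assume "0 < e"
      then obtain k where "1 / real (Suc k) < e" using nat_approx_posE by blast
      moreover obtain q where "q \<in> Q k" "dist x q < 1 / real (Suc k)" using Q(2) by blast
      ultimately show "\<exists>y\<in>\<Union>k. Q k. dist y x < e"
        by (intro bexI[of _ q]) (auto simp: dist_commute)
    qed
    then show "closure (\<Union>k. Q k) = UNIV" by blast
  qed
qed

section \<open>Measurability and almost sure growth of the word numbers\<close>

context continuous_bundle_rds
begin

lemma rds_iter_measurable: "(\<lambda>\<omega>. rds_iter \<theta> T n \<omega> x) \<in> borel_measurable P"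
proof (induction n)
  case (Suc n)
  have "(\<lambda>\<omega>. ((\<theta> ^^ n) \<omega>, rds_iter \<theta> T n \<omega> x)) \<in> measurable P (P \<Otimes>\<^sub>M borel)"
    using funpow_measurable Suc by (rule measurable_Pair)
  from measurable_compose[OF this measurable_rds] show ?case
    by simp
qed simp

text \<open>Continuity of the iterates needs continuity of \<open>T\<close> along the whole forward
  orbit, which excludes countably many null sets. Forward invariance of \<open>\<Omega>\<close> will
  keep the process subadditive after it is set to 0 elsewhere.\<close>

lemma continuity_set:
  obtains \<Omega> where "\<Omega> \<in> sets P" "AE \<omega> in P. \<omega> \<in> \<Omega>"
    "\<forall>\<omega>\<in>\<Omega>. \<forall>n. (\<theta> ^^ n) \<omega> \<in> \<Omega>"
    "\<forall>\<omega>\<in>\<Omega>. \<forall>n. continuous_on UNIV (rds_iter \<theta> T n \<omega>)"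
proof -
  obtain N where N: "{\<omega> \<in> space P. \<not> continuous_on UNIV (T \<omega>)} \<subseteq> N" "N \<in> null_sets P"
    using continuous_rds by (auto simp: eventually_ae_filter)
  define G where "G = space P - N"
  have G[measurable]: "G \<in> sets P" using N(2) by (auto simp: G_def)
  have cont: "continuous_on UNIV (T \<omega>)" if "\<omega> \<in> G" for \<omega>
    using N(1) that by (auto simp: G_def)
  have "AE \<omega> in P. \<omega> \<in> G"
    using AE_not_in[OF N(2)] AE_space by eventually_elim (simp add: G_def)
  note funpow_measurable[measurable]
  define \<Omega> where "\<Omega> = {\<omega>\<in>space P. \<forall>n. (\<theta> ^^ n) \<omega> \<in> G}"
  show ?thesis
  proof
    show "\<Omega> \<in> sets P" unfolding \<Omega>_def by measurable
    have "AE \<omega> in P. \<forall>n. (\<theta> ^^ n) \<omega> \<in> G"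
      unfolding AE_all_countable using AE_funpow[OF \<open>AE \<omega> in P. \<omega> \<in> G\<close>] by blast
    then show "AE \<omega> in P. \<omega> \<in> \<Omega>"
      using AE_space by eventually_elim (simp add: \<Omega>_def)
    show "\<forall>\<omega>\<in>\<Omega>. \<forall>n. (\<theta> ^^ n) \<omega> \<in> \<Omega>"
    proof (intro ballI allI)
      fix \<omega> n assume "\<omega> \<in> \<Omega>"
      moreover have "(\<theta> ^^ k) ((\<theta> ^^ n) \<omega>) = (\<theta> ^^ (k + n)) \<omega>" for k
        by (simp add: funpow_add)
      ultimately show "(\<theta> ^^ n) \<omega> \<in> \<Omega>"
        using funpow_space by (simp add: \<Omega>_def)
    qed
    show "\<forall>\<omega>\<in>\<Omega>. \<forall>n. continuous_on UNIV (rds_iter \<theta> T n \<omega>)"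
    proof (intro ballI allI)
      fix \<omega> n assume "\<omega> \<in> \<Omega>"
      then have T: "continuous_on UNIV (T ((\<theta> ^^ k) \<omega>))" for k
        by (intro cont) (simp add: \<Omega>_def)
      show "continuous_on UNIV (rds_iter \<theta> T n \<omega>)"
      proof (induction n)
        case (Suc n)
        then show ?case
          unfolding rds_iter.simps by (rule continuous_on_compose) (rule continuous_on_subset[OF T subset_UNIV])
      qed (simp add: id_def)
    qed
  qed
qed

text \<open>The points served by one of finitely many words form a closed set, by continuity; it is
  the whole space once it contains \<open>S\<close>.\<close>

lemma word_cover_on_dense:
  assumes "finite W" "closure S = UNIV" and cont: "\<And>n. continuous_on UNIV (rds_iter \<theta> T n \<omega>)"
  shows "word_cover \<theta> T \<delta> n \<omega> W \<longleftrightarrow> (\<forall>x\<in>S. \<exists>w\<in>W. \<forall>i<n. dist (rds_iter \<theta> T i \<omega> x) (w ! i) \<le> \<delta>)"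
proof -
  define A where "A = (\<Union>w\<in>W. \<Inter>i\<in>{..<n}. {x. dist (rds_iter \<theta> T i \<omega> x) (w ! i) \<le> \<delta>})"
  have A: "x \<in> A \<longleftrightarrow> (\<exists>w\<in>W. \<forall>i<n. dist (rds_iter \<theta> T i \<omega> x) (w ! i) \<le> \<delta>)" for x
    by (simp add: A_def) (simp add: Ball_def)
  have "closed A"
    unfolding A_def using \<open>finite W\<close> cont
    by (intro closed_UN closed_INT ballI closed_Collect_le continuous_on_dist continuous_on_const) auto
  then have "S \<subseteq> A \<longleftrightarrow> (\<forall>x. x \<in> A)"
    using closure_minimal[of S A] \<open>closure S = UNIV\<close> by (metis UNIV_I subset_eq)
  then show ?thesis
    unfolding word_cover_def A[symmetric] by (simp add: subset_eq)
qed

text \<open>On \<open>\<Omega>\<close> a cover is tested at countably many points, each giving a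
  measurable condition, and only finitely many \<open>W\<close> compete in the minimum.\<close>

lemma word_number_measurable:
  assumes "compact (UNIV :: 'x set)" "finite Q" and [measurable]: "\<Omega> \<in> sets P"
    and cont: "\<forall>\<omega>\<in>\<Omega>. \<forall>n. continuous_on UNIV (rds_iter \<theta> T n \<omega>)"
  shows "(\<lambda>\<omega>. if \<omega> \<in> \<Omega> then ln (real (word_number \<theta> T Q \<delta> n \<omega>)) else 0) \<in> borel_measurable P"
proof -
  obtain S :: "'x set" where S: "countable S" "closure S = UNIV"
    by (rule compact_UNIV_countable_dense[OF assms(1)])
  let ?C = "\<lambda>\<omega> W. \<forall>x\<in>S. \<exists>w\<in>W. \<forall>i<n. dist (rds_iter \<theta> T i \<omega> x) (w ! i) \<le> \<delta>"
  let ?N = "\<lambda>\<omega>. LEAST k. \<exists>W\<in>Pow (words Q n). ?C \<omega> W \<and> card W = k"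
  have fin: "finite W" if "W \<in> Pow (words Q n)" for W
    using that finite_words[OF \<open>finite Q\<close>] finite_subset by blast
  have ball[measurable]: "Measurable.pred P (\<lambda>\<omega>. dist (rds_iter \<theta> T i \<omega> x) q \<le> \<delta>)" for i x q
  proof -
    have "(\<lambda>\<omega>. rds_iter \<theta> T i \<omega> x) -` cball q \<delta> \<inter> space P \<in> sets P"
      by (intro measurable_sets[OF rds_iter_measurable] borel_closed closed_cball)
    moreover have "(\<lambda>\<omega>. rds_iter \<theta> T i \<omega> x) -` cball q \<delta> \<inter> space P
        = {\<omega>\<in>space P. dist (rds_iter \<theta> T i \<omega> x) q \<le> \<delta>}"
      by (auto simp: dist_commute)
    ultimately show ?thesis by (simp add: pred_def)
  qed
  have "Measurable.pred P (\<lambda>\<omega>. ?C \<omega> W)" if "W \<in> Pow (words Q n)" for W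
    using S(1) fin[OF that] by measurable
  then have "Measurable.pred P (\<lambda>\<omega>. ?C \<omega> W \<and> card W = k)" if "W \<in> Pow (words Q n)" for W k
    using that by (intro pred_intros_logic) auto
  then have "Measurable.pred P (\<lambda>\<omega>. \<exists>W\<in>Pow (words Q n). ?C \<omega> W \<and> card W = k)" for k
    using finite_words[OF \<open>finite Q\<close>] by (intro pred_intros_finite(4)) auto
  then have [measurable]: "?N \<in> measurable P (count_space UNIV)"
    by (rule measurable_Least)
  have "(\<lambda>\<omega>. if \<omega> \<in> \<Omega> then ln (real (?N \<omega>)) else 0) \<in> borel_measurable P"
    by measurable
  moreover have "word_number \<theta> T Q \<delta> n \<omega> = ?N \<omega>" if "\<omega> \<in> \<Omega>" for \<omega>
    unfolding word_number_def
    using word_cover_on_dense[OF fin S(2) cont[rule_format, OF that]]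
    by (intro arg_cong[where f = Least] ext bex_cong) simp_all
  ultimately show ?thesis
    by (simp cong: if_cong)
qed

text \<open>The growth rate of the word numbers has a limit a.e., and they lie between the Bowen
  numbers at scales \<open>\<epsilon>\<close> and \<open>\<epsilon> / 4\<close>. So the upper rate
  at the coarse scale is at most the lower rate at the fine one.\<close>

lemma AE_limsup_bowen_le_lower_growth:
  assumes compact: "compact (UNIV :: 'x set)" and "0 < \<epsilon>"
  shows "AE \<omega> in P. limsup (\<lambda>n. ln_enat (span_number (bowen_dist \<theta> T \<omega> n) \<epsilon>) / ereal (real n))
    \<le> lower_growth (bowen_dist \<theta> T \<omega>)"
proof -
  define \<delta> where "\<delta> = \<epsilon> / 2"
  have "0 < \<delta>" using \<open>0 < \<epsilon>\<close> by (simp add: \<delta>_def)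
  obtain Q :: "'x set" where Q: "finite Q" "\<And>x. \<exists>q\<in>Q. dist x q < \<delta> / 2"
    using compact_UNIV_finite_net[OF compact, of "\<delta> / 2"] \<open>0 < \<delta>\<close> by auto
  have net: "\<exists>q\<in>Q. dist x q \<le> \<delta> / 2" for x
    using Q(2) less_imp_le by blast
  obtain \<Omega> where \<Omega>: "\<Omega> \<in> sets P" "AE \<omega> in P. \<omega> \<in> \<Omega>" "\<forall>\<omega>\<in>\<Omega>. \<forall>n. (\<theta> ^^ n) \<omega> \<in> \<Omega>"
    "\<forall>\<omega>\<in>\<Omega>. \<forall>n. continuous_on UNIV (rds_iter \<theta> T n \<omega>)"
    by (rule continuity_set)
  let ?N = "word_number \<theta> T Q \<delta>"
  let ?a = "\<lambda>n \<omega>. if \<omega> \<in> \<Omega> then ln (real (?N n \<omega>)) else 0"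
  note pos = word_number_pos[OF Q(1) net, of \<theta> T]
  have ln_nonneg: "0 \<le> ln (real (?N n \<omega>))" for n \<omega>
    using pos[of n \<omega>] by (simp add: Suc_le_eq)
  have "Q \<noteq> {}" using Q(2) by blast
  then have card_pos: "1 \<le> card Q" using Q(1) by (simp add: Suc_le_eq card_gt_0_iff)
  interpret bounded_subadditive_process P \<theta> ?a "ln (real (card Q))"
  proof unfold_locales
    fix n m \<omega>
    show "?a n \<in> borel_measurable P"
      by (rule word_number_measurable[OF compact Q(1) \<Omega>(1,4)])
    show "0 \<le> ?a n \<omega>"
      using ln_nonneg by simp
    have "ln (real (?N n \<omega>)) \<le> ln (real (card Q ^ n))"
      using word_number_le_power[OF Q(1) net, of \<theta> T n \<omega>] pos[of n \<omega>]
      by (intro ln_mono) (simp_all only: of_nat_le_iff of_nat_0_less_iff)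
    then show "?a n \<omega> \<le> ln (real (card Q)) * real n"
      using card_pos by (simp add: ln_realpow mult.commute)
    have "ln (real (?N (m + n) \<omega>)) \<le> ln (real (?N m \<omega> * ?N n ((\<theta> ^^ m) \<omega>)))"
      using word_number_submultiplicative[OF Q(1) net, of \<theta> T m n \<omega>] pos[of "m + n" \<omega>]
      by (intro ln_mono) (simp_all only: of_nat_le_iff of_nat_0_less_iff)
    also have "\<dots> = ln (real (?N m \<omega>)) + ln (real (?N n ((\<theta> ^^ m) \<omega>)))"
      using pos by (simp add: ln_mult)
    \<comment> \<open>Inside \<open>\<Omega>\<close> the shifted point is again in
      \<open>\<Omega>\<close>; outside, the left side is 0 and the right side nonnegative.\<close>
    finally show "?a (m + n) \<omega> \<le> ?a m \<omega> + ?a n ((\<theta> ^^ m) \<omega>)"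
      using \<Omega>(3) ln_nonneg by simp
  qed
  from AE_limsup_eq_liminf \<Omega>(2) show ?thesis
  proof eventually_elim
    case (elim \<omega>)
    have a: "ereal (?a n \<omega> / real n) = ln_enat (enat (?N n \<omega>)) / ereal (real n)" if "0 < n" for n
      using elim(2) that by (simp add: ln_enat_def)
    have "limsup (\<lambda>n. ln_enat (span_number (bowen_dist \<theta> T \<omega> n) \<epsilon>) / ereal (real n))
        \<le> limsup (\<lambda>n. ereal (?a n \<omega> / real n))"
    proof (rule Limsup_mono, rule eventually_mono[OF eventually_gt_at_top[of 0]])
      fix n :: nat assume "0 < n"
      then show "ln_enat (span_number (bowen_dist \<theta> T \<omega> n) \<epsilon>) / ereal (real n) \<le> ereal (?a n \<omega> / real n)"
        unfolding a[OF \<open>0 < n\<close>]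
        using span_number_le_word_number[OF Q(1) net \<open>0 < n\<close>, of \<theta> T \<omega>]
        by (intro ln_enat_divide_mono span_number_pos) (simp add: \<delta>_def)
    qed
    also have "\<dots> = liminf (\<lambda>n. ereal (?a n \<omega> / real n))"
      by (rule elim(1))
    also have "\<dots> \<le> liminf (\<lambda>n. ln_enat (span_number (bowen_dist \<theta> T \<omega> n) (\<delta> / 2)) / ereal (real n))"
    proof (rule Liminf_mono, rule eventually_mono[OF eventually_gt_at_top[of 0]])
      fix n :: nat assume "0 < n"
      show "ereal (?a n \<omega> / real n) \<le> ln_enat (span_number (bowen_dist \<theta> T \<omega> n) (\<delta> / 2)) / ereal (real n)"
        unfolding a[OF \<open>0 < n\<close>]
        using pos[of n \<omega>] by (intro ln_enat_divide_mono word_number_le_span_number Q(1) net) (simp add: zero_enat_def)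
    qed
    also have "\<dots> \<le> lower_growth (bowen_dist \<theta> T \<omega>)"
      unfolding lower_growth_eq_SUP using \<open>0 < \<delta>\<close> by (intro SUP_upper) auto
    finally show ?case .
  qed
qed

text \<open>The exceptional null set depends on the scale. Countably many scales
  \<open>1 / real (Suc k)\<close> are treated at once, and monotonicity covers the others.\<close>

lemma AE_bowen_upper_growth_le_lower_growth:
  assumes compact: "compact (UNIV :: 'x set)"
  shows "AE \<omega> in P. upper_growth (bowen_dist \<theta> T \<omega>) \<le> lower_growth (bowen_dist \<theta> T \<omega>)"
proof -
  let ?F = "\<lambda>\<omega> \<epsilon>. limsup (\<lambda>n. ln_enat (span_number (bowen_dist \<theta> T \<omega> n) \<epsilon>) / ereal (real n))"
  have "AE \<omega> in P. \<forall>k. ?F \<omega> (1 / real (Suc k)) \<le> lower_growth (bowen_dist \<theta> T \<omega>)"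
    unfolding AE_all_countable by (intro allI AE_limsup_bowen_le_lower_growth[OF compact]) simp
  then show ?thesis
  proof eventually_elim
    case (elim \<omega>)
    show ?case
      unfolding upper_growth_eq_SUP
    proof (rule SUP_least)
      fix \<epsilon> :: real assume "\<epsilon> \<in> {0<..}"
      then obtain k where k: "1 / real (Suc k) < \<epsilon>" using nat_approx_posE by auto
      have "?F \<omega> \<epsilon> \<le> ?F \<omega> (1 / real (Suc k))"
      proof (rule Limsup_mono, rule always_eventually, rule allI)
        show "ln_enat (span_number (bowen_dist \<theta> T \<omega> n) \<epsilon>) / ereal (real n)
            \<le> ln_enat (span_number (bowen_dist \<theta> T \<omega> n) (1 / real (Suc k))) / ereal (real n)" for n
          using k by (intro ln_enat_divide_mono span_number_mono span_number_pos) simp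
      qed
      also have "\<dots> \<le> lower_growth (bowen_dist \<theta> T \<omega>)"
        using elim by blast
      finally show "?F \<omega> \<epsilon> \<le> lower_growth (bowen_dist \<theta> T \<omega>)" .
    qed
  qed
qed

end

theorem theorem1p1:
  fixes P :: "'w measure" and \<theta> :: "'w \<Rightarrow> 'w"
    and T :: "'w \<Rightarrow> 'x::metric_space \<Rightarrow> 'x"
  assumes "compact (UNIV :: 'x set)"
    and "continuous_bundle_rds P \<theta> T"
  shows "AE \<omega> in P.
           fiber_top_entropy \<theta> T \<omega> = upper_growth (bowen_dist \<theta> T \<omega>) \<and>
           fiber_top_entropy \<theta> T \<omega> = fk_entropy_upper \<theta> T \<omega> \<and>
           fk_entropy_upper \<theta> T \<omega> = fk_entropy_lower \<theta> T \<omega>"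
proof -
  interpret continuous_bundle_rds P \<theta> T by fact
  from AE_bowen_upper_growth_le_lower_growth[OF assms(1)] show ?thesis
  proof eventually_elim
    case (elim \<omega>)
    have "lower_growth (bowen_dist \<theta> T \<omega>) \<le> lower_growth (fk_dist \<theta> T \<omega>)"
      by (rule lower_growth_bowen_le_fk[OF assms(1)])
    moreover have "lower_growth (fk_dist \<theta> T \<omega>) \<le> upper_growth (fk_dist \<theta> T \<omega>)"
      by (rule lower_growth_le_upper_growth)
    moreover have "upper_growth (fk_dist \<theta> T \<omega>) \<le> upper_growth (bowen_dist \<theta> T \<omega>)"
      by (intro upper_growth_mono fk_dist_le_bowen_dist)
    ultimately show ?case
      using elim unfolding fiber_top_entropy_def fk_entropy_upper_def fk_entropy_lower_def
      by (intro conjI; order)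
  qed
qed

end
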